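(* Let $\delta\in(0,1/3)$, $n\ge1$, $d\ge1$ and let $k$ be an integer with $k\ge8\log(4(2n+1)^{d+1}/\delta)$. Let $\mathcal V(x)=B(x,\hat\tau_{n,k}(x))$ be the $k$-nearest neighbors local map. Suppose that $(X,Y),(X_1,Y_1),\dots,(X_n,Y_n)$ are i.i.d., that $\varepsilon=Y-g(X)$ is sub-Gaussian conditionally on $X$ with parameter $\sigma^2$, that $g$ is $L$-Lipschitz on $S_X$, and that there are a positive function $\ell$ on $S_X$ and $T_0>0$ such that $P^X(B(x,\tau))\ge\ell(x)\tau^d$ for all $x\in S_X$ and $\tau\in(0,T_0)$. Then, with probability at least $1-3\delta$, for all $x\in S_X$ such that $2k\le T_0^d\,n\,\ell(x)$, $$|\hat g_{\mathcal V}(x)-g(x)|\le\sqrt{\frac{2\sigma^2\log((n+1)^{d+1}/\delta)}{k}}+2\left(\frac{2k}{n\ell(x)}\right)^{1/d}L(\mathcal V(x)).$$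
   Context: Setting: $(X,Y)$ is a random vector with law $P$ on $\mathbb R^d\times\mathbb R$, $X$ takes values in $S_X\subset\mathbb R^d$ and has law $P^X$, $g(x)=\mathbb E[Y\mid X=x]$, $\varepsilon=Y-g(X)$. Sub-Gaussian conditionally on $X$ with parameter $\sigma^2$: $\mathbb E[\varepsilon\mid X]=0$ and $\mathbb E[\exp(t\varepsilon)\mid X]\le\exp(t^2\sigma^2/2)$ a.s. for all $t\in\mathbb R$. $B(x,\tau)$ is the closed Euclidean ball with center $x$ and radius $\tau$. The $k$-NN radius $\hat\tau_{n,k}(x)$ is the smallest $\tau>0$ such that $\sum_{i=1}^n\mathbf 1_{B(x,\tau)}(X_i)\ge k$. The estimator is $$\hat g_{\mathcal V}(x)=\frac{\sum_{i=1}^nY_i\mathbf 1_{\mathcal V(x)}(X_i)}{\sum_{i=1}^n\mathbf 1_{\mathcal V(x)}(X_i)},\qquad0/0=0,$$ i.e. the average response over the $k$ nearest neighbors of $x$ (when there are no ties). Lipschitz is with respect to $\|\cdot\|_2$. $L(V)$ is the smallest constant such that $|g(y)-g(z)|\le L(V)\|y-z\|_2$ for all $y,z\in V\cap S_X$. *)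

theory Defs
  imports "HOL-Probability.Probability"
begin

definition iid :: "'w measure \<Rightarrow> 'i set \<Rightarrow> ('i \<Rightarrow> 'w \<Rightarrow> 'b::topological_space) \<Rightarrow> bool" where
  "iid M I Z \<longleftrightarrow> prob_space.indep_vars M (\<lambda>_. borel) Z I \<and>
     (\<forall>i\<in>I. \<forall>j\<in>I. distr M borel (Z i) = distr M borel (Z j))"

definition sigma_gen :: "'w measure \<Rightarrow> ('w \<Rightarrow> 'a::topological_space) \<Rightarrow> 'w measure" where
  "sigma_gen M X = vimage_algebra (space M) X borel"

text \<open>\<open>g\<close> is a version of \<open>x \<mapsto> E[Y | X = x]\<close>. Integrability of \<open>Y\<close> is what makes the
  library's conditional expectation meaningful.\<close>

definition regression_fun ::
  "'w measure \<Rightarrow> ('w \<Rightarrow> 'a::topological_space) \<Rightarrow> ('w \<Rightarrow> real) \<Rightarrow> ('a \<Rightarrow> real) \<Rightarrow> bool" where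
  "regression_fun M X Y g \<longleftrightarrow> integrable M Y \<and> g \<in> borel_measurable borel \<and>
     (AE \<omega> in M. real_cond_exp M (sigma_gen M X) Y \<omega> = g (X \<omega>))"

text \<open>The exponential moments are conditioned with \<^const>\<open>nn_cond_exp\<close>, because
  \<^const>\<open>real_cond_exp\<close> returns \<open>0\<close> where the conditional expectation is infinite.\<close>

definition cond_sub_gaussian ::
  "'w measure \<Rightarrow> ('w \<Rightarrow> 'a::topological_space) \<Rightarrow> ('w \<Rightarrow> real) \<Rightarrow> real \<Rightarrow> bool" where
  "cond_sub_gaussian M X e v \<longleftrightarrow>
     (AE \<omega> in M. real_cond_exp M (sigma_gen M X) e \<omega> = 0) \<and>
     (\<forall>t::real. AE \<omega> in M.
        nn_cond_exp M (sigma_gen M X) (\<lambda>\<omega>. ennreal (exp (t * e \<omega>))) \<omega>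
          \<le> ennreal (exp (t\<^sup>2 * v / 2)))"

text \<open>The infimum is attained unless at least \<open>k\<close> sample points coincide with \<open>x\<close>; in that
  case the radius is \<open>0\<close>, and the closed ball of radius \<open>0\<close> still contains those points.
  The value is meaningless if \<open>k > n\<close>.\<close>

definition knn_radius :: "nat \<Rightarrow> nat \<Rightarrow> (nat \<Rightarrow> 'a::metric_space) \<Rightarrow> 'a \<Rightarrow> real" where
  "knn_radius n k xs x =
     Inf {\<tau>. 0 < \<tau> \<and> real k \<le> (\<Sum>i=1..n. indicator (cball x \<tau>) (xs i))}"

definition knn_map :: "nat \<Rightarrow> nat \<Rightarrow> (nat \<Rightarrow> 'a::metric_space) \<Rightarrow> 'a \<Rightarrow> 'a set" where
  "knn_map n k xs x = cball x (knn_radius n k xs x)"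

definition local_estimator ::
  "nat \<Rightarrow> (nat \<Rightarrow> 'a) \<Rightarrow> (nat \<Rightarrow> real) \<Rightarrow> ('a \<Rightarrow> 'a set) \<Rightarrow> 'a \<Rightarrow> real" where
  "local_estimator n xs ys V x =
     (\<Sum>i=1..n. ys i * indicator (V x) (xs i)) / (\<Sum>i=1..n. indicator (V x) (xs i))"

definition lipschitz_const :: "('a::metric_space \<Rightarrow> real) \<Rightarrow> 'a set \<Rightarrow> 'a set \<Rightarrow> real" where
  "lipschitz_const g S V = Inf {C. C-lipschitz_on (V \<inter> S) g}"

end

theory Submission
  imports Defs
begin

text \<open>Both sources of error are controlled by integrating an exponential weight \<open>\<Prod>\<close> over the sample
  points in a ball, maximised over all balls \<open>B\<close>; the maximum is bounded by a sum over the at most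
  \<open>(m + 1) ^ (d + 1)\<close> subsets that balls cut out of \<open>m\<close> points.

  Radius: let \<open>N\<close> and \<open>N'\<close> count the points of the sample and of an independent ghost sample in \<open>B\<close>.
  Randomly exchanging each point with its ghost shows
  \<open>E [sup\<^sub>B (2/3) ^ N * (4/3) ^ N'] \<le> (2 n + 1) ^ (d + 1)\<close>. If \<open>P B \<ge> 2 k / n\<close> but \<open>N < k\<close>, Jensen's
  inequality in the ghost sample bounds the weight below by \<open>(2/3) ^ k * (4/3) ^ (2 k) = (32/27) ^ k\<close>, and
  \<open>27/32 \<le> exp (-1/8)\<close>. So with high probability every ball of mass at least \<open>2 k / n\<close> contains
  \<open>k\<close> points, which bounds the nearest neighbour radius by \<open>(2 k / (n l x)) powr (1 / d)\<close>.

  Noise: conditionally on the design, \<open>exp (t * \<epsilon>\<^sub>i - t\<^sup>2 * \<sigma>\<^sup>2 / 2)\<close> has mean at most \<open>1\<close>, so the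
  supremum over \<open>B\<close> of its product over the points in \<open>B\<close> has mean at most \<open>(n + 1) ^ (d + 1)\<close>; Markov's
  inequality with one fixed \<open>t\<close> then serves all balls with at least \<open>k\<close> points at once.\<close>

section \<open>Traces of closed balls\<close>

text \<open>Traces are sets of indices, not of points, so coinciding sample points need no special care.\<close>

definition trace_of :: "'i set \<Rightarrow> ('i \<Rightarrow> 'a) \<Rightarrow> 'a set \<Rightarrow> 'i set" where
  "trace_of I x B = {i \<in> I. x i \<in> B}"

section \<open>Counting families of index sets by the sets they shatter\<close>

text \<open>Deleting \<open>a\<close> merges two members of \<open>F\<close> exactly when they
  differ only in \<open>a\<close>, and the second family counts these merged pairs. Both families
  live on \<open>I\<close>, which is what an induction over the ground set needs.\<close>

lemma card_Pow_insert_split: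
  assumes I: "finite I" and a: "a \<notin> I" and F: "F \<subseteq> Pow (insert a I)"
  shows "card F = card ((\<lambda>A. A - {a}) ` F) + card {A \<in> F. a \<notin> A \<and> insert a A \<in> F}"
proof -
  let ?r = "\<lambda>A. A - {a}"
  define F0 where "F0 = {A \<in> F. a \<notin> A}"
  define F1 where "F1 = ?r ` {A \<in> F. a \<in> A}"
  have fin: "finite F"
    using I F finite_subset by fastforce
  have inj: "inj_on ?r {A \<in> F. a \<in> A}"
    by (auto simp: inj_on_def)
  have "card F = card (F0 \<union> {A \<in> F. a \<in> A})"
    by (rule arg_cong[where f = card]) (auto simp: F0_def)
  also have "\<dots> = card F0 + card {A \<in> F. a \<in> A}"
    using fin by (intro card_Un_disjoint) (auto simp: F0_def)
  also have "card {A \<in> F. a \<in> A} = card F1"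
    unfolding F1_def using inj by (simp add: card_image)
  also have "card F0 + card F1 = card (F0 \<union> F1) + card (F0 \<inter> F1)"
    using fin by (intro card_Un_Int) (auto simp: F0_def F1_def)
  also have "F0 \<union> F1 = ?r ` F"
  proof -
    have "?r ` F0 = (\<lambda>A. A) ` F0"
      by (rule image_cong) (auto simp: F0_def)
    then have "F0 \<union> F1 = ?r ` (F0 \<union> {A \<in> F. a \<in> A})"
      unfolding F1_def image_Un by simp
    also have "F0 \<union> {A \<in> F. a \<in> A} = F" by (auto simp: F0_def)
    finally show ?thesis .
  qed
  also have "F0 \<inter> F1 = {A \<in> F. a \<notin> A \<and> insert a A \<in> F}"
  proof -
    have "A \<in> F1 \<longleftrightarrow> insert a A \<in> F" if "a \<notin> A" for A
    proof
      assume "A \<in> F1"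
      then obtain B where "B \<in> F" "a \<in> B" "A = B - {a}" unfolding F1_def by blast
      then show "insert a A \<in> F" by (simp add: insert_absorb)
    next
      assume "insert a A \<in> F"
      then show "A \<in> F1"
        unfolding F1_def using that by (intro image_eqI[of _ _ "insert a A"]) auto
    qed
    then show ?thesis unfolding F0_def by blast
  qed
  finally show ?thesis .
qed

text \<open>Pajor's form of the Sauer--Shelah lemma: it needs no arithmetic with binomial sums.\<close>

lemma card_le_card_shattered:
  assumes "finite I" and "F \<subseteq> Pow I"
  shows "card F \<le> card {J. J \<subseteq> I \<and> (\<inter>) J ` F = Pow J}"
  using assms
proof (induction I arbitrary: F rule: finite_induct)
  case empty
  have "F = {} \<or> F = {{}}"
    using empty by auto
  then show ?case
  proof
    assume "F = {{}}"
    then have "{J. J \<subseteq> {} \<and> (\<inter>) J ` F = Pow J} = {{}}" by auto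
    with \<open>F = {{}}\<close> show ?thesis by simp
  qed simp
next
  case (insert a I)
  let ?sh = "\<lambda>I F. {J. J \<subseteq> I \<and> (\<inter>) J ` F = Pow J}"
  let ?F0 = "(\<lambda>A. A - {a}) ` F" and ?F1 = "{A \<in> F. a \<notin> A \<and> insert a A \<in> F}"
  have fin: "finite (?sh (insert a I) F)"
    using insert.hyps by simp
  have F0: "?F0 \<subseteq> Pow I" and F1: "?F1 \<subseteq> Pow I"
    using insert.prems by auto
  have sub0: "?sh I ?F0 \<subseteq> {J \<in> ?sh (insert a I) F. a \<notin> J}"
  proof
    fix J assume J: "J \<in> ?sh I ?F0"
    then have "a \<notin> J" using insert.hyps by auto
    then have "(\<inter>) J ` ?F0 = (\<inter>) J ` F"
      by (simp add: image_image Diff_eq Int_assoc[symmetric]) (rule image_cong, auto)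
    with J \<open>a \<notin> J\<close> show "J \<in> {J \<in> ?sh (insert a I) F. a \<notin> J}" by auto
  qed
  \<comment> \<open>Every set in \<open>?F1\<close> lies in \<open>F\<close> both with and without
    \<open>a\<close>. So whatever \<open>?F1\<close> cuts out of \<open>J\<close> can be completed
    in \<open>F\<close> with either choice at \<open>a\<close>, and \<open>insert a J\<close> is
    shattered.\<close>
  have sub1: "insert a ` ?sh I ?F1 \<subseteq> {J \<in> ?sh (insert a I) F. a \<in> J}"
  proof
    fix K assume "K \<in> insert a ` ?sh I ?F1"
    then obtain J where K: "K = insert a J" and J: "J \<subseteq> I" "(\<inter>) J ` ?F1 = Pow J" by auto
    have "B \<in> (\<inter>) K ` F" if "B \<subseteq> K" for B
    proof -
      have "B - {a} \<in> (\<inter>) J ` ?F1"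
        unfolding J using that K by auto
      then obtain A where A: "A \<in> ?F1" "B - {a} = J \<inter> A" by blast
      show ?thesis
      proof (cases "a \<in> B")
        case True
        have "B = K \<inter> insert a A" using A(2) K True by auto
        then show ?thesis using A(1) by blast
      next
        case False
        have "B = K \<inter> A" using A K False by auto
        then show ?thesis using A(1) by blast
      qed
    qed
    then show "K \<in> {J \<in> ?sh (insert a I) F. a \<in> J}" using K J by auto
  qed
  have inj: "inj_on (insert a) (?sh I ?F1)"
  proof (rule inj_on_subset)
    show "inj_on (insert a) {J. a \<notin> J}" by (rule inj_onI) (simp add: insert_ident)
  qed (use insert.hyps in auto)
  define Sh where "Sh = ?sh (insert a I) F"
  note sub = sub0[folded Sh_def] sub1[folded Sh_def] and fin = fin[folded Sh_def]
  have "card F = card ?F0 + card ?F1"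
    using insert.hyps insert.prems by (intro card_Pow_insert_split)
  also have "\<dots> \<le> card (?sh I ?F0) + card (?sh I ?F1)"
    by (intro add_mono insert.IH F0 F1)
  also have "card (?sh I ?F1) = card (insert a ` ?sh I ?F1)"
    using inj by (rule card_image[symmetric])
  also have "card (?sh I ?F0) + card (insert a ` ?sh I ?F1)
      \<le> card {J \<in> Sh. a \<notin> J} + card {J \<in> Sh. a \<in> J}"
    by (intro add_mono card_mono sub) (simp_all add: fin)
  also have "\<dots> = card ({J \<in> Sh. a \<notin> J} \<union> {J \<in> Sh. a \<in> J})"
    using fin by (intro card_Un_disjoint[symmetric]) auto
  also have "{J \<in> Sh. a \<notin> J} \<union> {J \<in> Sh. a \<in> J} = Sh" by auto
  also note Sh_def
  finally show ?case .
qed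

text \<open>A nonempty set of size at most \<open>Suc D\<close> is a set of size at most
  \<open>D\<close> with one point added. \<open>None\<close> stands for adding nothing, so each unit
  of \<open>D\<close> costs a factor \<open>card I + 1\<close>.\<close>

lemma card_small_subsets_le:
  assumes "finite I"
  shows "card {J. J \<subseteq> I \<and> card J \<le> D} \<le> (card I + 1) ^ D"
proof (induction D)
  case 0
  have "{J. J \<subseteq> I \<and> card J \<le> 0} = {{}}"
    using assms by (auto simp: finite_subset)
  then show ?case by simp
next
  case (Suc D)
  let ?S = "{J. J \<subseteq> I \<and> card J \<le> D}"
  let ?f = "\<lambda>(J, z). case z of None \<Rightarrow> J | Some x \<Rightarrow> insert x J"
  let ?Z = "insert None (Some ` I)"
  have fin: "finite (?S \<times> ?Z)" using assms by auto
  have "J \<in> ?f ` (?S \<times> ?Z)" if J: "J \<subseteq> I" "card J \<le> Suc D" for J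
  proof (cases "J = {}")
    case True
    then show ?thesis by (intro image_eqI[of _ _ "({}, None)"]) auto
  next
    case False
    then obtain x where x: "x \<in> J" by auto
    have "finite J" using J assms finite_subset by auto
    with x J have "card (J - {x}) \<le> D" by (simp add: card_Diff_singleton)
    with x J show ?thesis
      by (intro image_eqI[of _ _ "(J - {x}, Some x)"]) auto
  qed
  then have "card {J. J \<subseteq> I \<and> card J \<le> Suc D} \<le> card (?f ` (?S \<times> ?Z))"
    using fin by (intro card_mono) auto
  also have "\<dots> \<le> card (?S \<times> ?Z)"
    using fin by (rule card_image_le)
  also have "\<dots> = card ?S * (card I + 1)"
    using assms by (simp add: card_cartesian_product card_image)
  also have "\<dots> \<le> (card I + 1) ^ D * (card I + 1)"
    using Suc by (rule mult_right_mono) simp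
  finally show ?case by (simp add: mult.commute)
qed

text \<open>An affine dependence \<open>c\<close> of the points can be signed so that \<open>\<Sum> c i * |x i|\<^sup>2 \<ge> 0\<close>;
  this sum also equals \<open>\<Sum> c i * (|x i - z|\<^sup>2 - r\<^sup>2)\<close>, which is negative for a ball that
  separates \<open>c > 0\<close> from \<open>c < 0\<close>.\<close>

lemma card_shattered_by_balls_le:
  fixes x :: "'i \<Rightarrow> 'a::euclidean_space"
  assumes J: "finite J" and sh: "\<And>A. A \<subseteq> J \<Longrightarrow> \<exists>z r. trace_of J x (cball z r) = A"
  shows "card J \<le> DIM('a) + 1"
proof (rule ccontr)
  assume "\<not> card J \<le> DIM('a) + 1"
  have inj: "inj_on x J"
  proof (rule inj_onI, rule ccontr)
    fix i j assume ij: "i \<in> J" "j \<in> J" "x i = x j" "i \<noteq> j"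
    obtain z r where "trace_of J x (cball z r) = {i}"
      using sh[of "{i}"] ij by auto
    with ij show False
      unfolding trace_of_def by (metis (mono_tags, lifting) mem_Collect_eq singletonD singletonI)
  qed
  then have "card (x ` J) \<ge> DIM('a) + 2"
    using \<open>\<not> card J \<le> DIM('a) + 1\<close> by (simp add: card_image)
  then have "affine_dependent (x ` J)"
    using J by (intro affine_dependent_biggerset) auto
  then obtain U where U: "sum U (x ` J) = 0" "\<exists>v\<in>x ` J. U v \<noteq> 0"
    "(\<Sum>v\<in>x ` J. U v *\<^sub>R v) = 0"
    using J by (auto simp: affine_dependent_explicit_finite)
  define s :: real where "s = (if (\<Sum>v\<in>x ` J. U v * (norm v)\<^sup>2) \<ge> 0 then 1 else -1)"
  define c where "c i = s * U (x i)" for i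
  have c0: "sum c J = 0" and c1: "(\<Sum>i\<in>J. c i *\<^sub>R x i) = 0"
    using U(1,3) inj by (simp_all add: c_def sum.reindex flip: sum_distrib_left scaleR_scaleR scaleR_right.sum)
  have c2: "(\<Sum>i\<in>J. c i * (norm (x i))\<^sup>2) \<ge> 0"
    using inj by (auto simp: c_def s_def sum.reindex mult.assoc sum_negf simp flip: sum_distrib_left)
  have "\<exists>i\<in>J. c i \<noteq> 0" using U(2) by (auto simp: c_def s_def)
  then obtain i0 where i0: "i0 \<in> J" "c i0 < 0"
    by (metis (no_types, lifting) J c0 linorder_neqE_linordered_idom not_le_imp_less sum_nonneg_eq_0_iff)
  obtain z r where zr: "trace_of J x (cball z r) = {i \<in> J. c i > 0}"
    using sh[of "{i \<in> J. c i > 0}"] by auto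
  then have pos: "x i \<in> cball z r \<longleftrightarrow> c i > 0" if "i \<in> J" for i
    using that unfolding trace_of_def by blast
  \<comment> \<open>Comparing squares is equivalent to comparing distances only for a nonnegative
    radius. The ball is nonempty: the weights sum to zero and one is negative, so some weight is
    positive.\<close>
  have "r \<ge> 0"
  proof -
    have "\<exists>i\<in>J. c i > 0"
    proof (rule ccontr)
      assume "\<not> (\<exists>i\<in>J. c i > 0)"
      then have "sum c J < 0"
        using i0 J sum_strict_mono_ex1[of J c "\<lambda>_. 0"] by force
      with c0 show False by simp
    qed
    then obtain i where "i \<in> J" "x i \<in> cball z r" using pos by auto
    then show ?thesis by (metis dist_not_less_zero linorder_not_le mem_cball order_le_less_trans)
  qed
  define f where "f i = (norm (x i - z))\<^sup>2 - r\<^sup>2" for i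
  have f: "f i \<le> 0 \<longleftrightarrow> c i > 0" if "i \<in> J" for i
    using pos[OF that] \<open>r \<ge> 0\<close> by (simp add: f_def dist_norm norm_minus_commute)
  have "c i * f i
      = c i * (norm (x i))\<^sup>2 - 2 * (c i *\<^sub>R x i \<bullet> z) + c i * ((norm z)\<^sup>2 - r\<^sup>2)" for i
    unfolding f_def power2_norm_eq_inner
    by (simp add: inner_diff_left inner_diff_right inner_commute algebra_simps)
  then have "(\<Sum>i\<in>J. c i * f i)
      = (\<Sum>i\<in>J. c i * (norm (x i))\<^sup>2) - 2 * ((\<Sum>i\<in>J. c i *\<^sub>R x i) \<bullet> z)
        + sum c J * ((norm z)\<^sup>2 - r\<^sup>2)"
    by (simp add: inner_sum_left sum_distrib_left sum_distrib_right sum.distrib sum_subtractf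
        del: inner_scaleR_left)
  also have "\<dots> \<ge> 0" using c0 c1 c2 by simp
  finally have "(\<Sum>i\<in>J. c i * f i) \<ge> 0" .
  moreover have "(\<Sum>i\<in>J. c i * f i) < 0"
  proof -
    have "c i * f i \<le> 0" if "i \<in> J" for i
      using f[OF that] by (cases "c i > 0") (auto simp: mult_le_0_iff)
    moreover have "c i0 * f i0 < 0"
      using f[OF i0(1)] i0(2) by (simp add: mult_less_0_iff)
    ultimately show ?thesis
      using i0 J sum_strict_mono_ex1[of J "\<lambda>i. c i * f i" "\<lambda>_. 0"] by auto
  qed
  ultimately show False by simp
qed

text \<open>A shattered index set has at most \<open>DIM('a) + 1\<close> elements, so the traces are
  at most as many as the subsets of that size. The exponent \<open>d + 1\<close> of the theorem
  comes from here.\<close>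

lemma card_ball_traces_le:
  fixes x :: "'i \<Rightarrow> 'a::euclidean_space"
  assumes I: "finite I" and Bs: "Bs \<subseteq> range (\<lambda>(z, r). cball z r)"
  shows "card (trace_of I x ` Bs) \<le> (card I + 1) ^ (DIM('a) + 1)"
proof -
  let ?F = "trace_of I x ` Bs"
  have "card J \<le> DIM('a) + 1" if J: "J \<subseteq> I" "(\<inter>) J ` ?F = Pow J" for J
  proof (rule card_shattered_by_balls_le)
    show "finite J" using J I finite_subset by auto
    fix A assume "A \<subseteq> J"
    then obtain B where "B \<in> Bs" "A = J \<inter> trace_of I x B" using J(2) by blast
    moreover have "J \<inter> trace_of I x B = trace_of J x B" using J(1) by (auto simp: trace_of_def)
    ultimately show "\<exists>z r. trace_of J x (cball z r) = A" using Bs by fastforce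
  qed
  then have "{J. J \<subseteq> I \<and> (\<inter>) J ` ?F = Pow J} \<subseteq> {J. J \<subseteq> I \<and> card J \<le> DIM('a) + 1}"
    by auto
  then have "card {J. J \<subseteq> I \<and> (\<inter>) J ` ?F = Pow J} \<le> card {J. J \<subseteq> I \<and> card J \<le> DIM('a) + 1}"
    using I by (intro card_mono) auto
  moreover have "card ?F \<le> card {J. J \<subseteq> I \<and> (\<inter>) J ` ?F = Pow J}"
    using I by (intro card_le_card_shattered) (auto simp: trace_of_def)
  ultimately show ?thesis
    using card_small_subsets_le[OF I, of "DIM('a) + 1"] by linarith
qed

section \<open>A countable family of balls that realises every trace\<close>

text \<open>Closed balls over which the exceptional events are taken: countably many, so that the events
  are measurable, yet every closed ball has a superset here with the same trace on the sample.\<close>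

definition rational_balls :: "'a::euclidean_space set set" where
  "rational_balls = (\<lambda>(z, r). cball z r) ` ((SOME D. countable D \<and> closure D = UNIV) \<times> \<rat>)"

lemma countable_dense_SOME:
  fixes D :: "'a::euclidean_space set"
  defines "D \<equiv> (SOME D. countable D \<and> closure D = UNIV)"
  shows "countable D" "closure D = UNIV"
proof -
  obtain D0 :: "'a set" where "countable D0" "\<And>X. open X \<Longrightarrow> X \<noteq> {} \<Longrightarrow> \<exists>d\<in>D0. d \<in> X"
    by (rule countable_dense_setE) blast
  then have "countable D0 \<and> closure D0 = UNIV"
    using closure_subset[of D0] open_Compl[OF closed_closure[of D0]] by blast
  then have "countable D \<and> closure D = UNIV" unfolding D_def by (rule someI)
  then show "countable D" "closure D = UNIV" by auto
qed

lemma countable_rational_balls: "countable rational_balls"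
  unfolding rational_balls_def using countable_dense_SOME(1) countable_rat by (intro countable_image countable_SIGMA)

lemma rational_balls_subset: "rational_balls \<subseteq> range (\<lambda>(z, r). cball z r)"
  by (auto simp: rational_balls_def)

text \<open>The finitely many points outside a closed ball keep a positive distance from it. This
  gives room for a rational ball, and later shows that the infimum defining the nearest neighbour
  radius still captures \<open>k\<close> points.\<close>

lemma cball_enlarge_same_trace:
  fixes xs :: "'i \<Rightarrow> 'a::metric_space"
  assumes "finite I"
  shows "\<exists>e>0. trace_of I xs (cball x (r + e)) = trace_of I xs (cball x r)"
proof -
  let ?O = "{i \<in> I. dist x (xs i) > r}"
  \<comment> \<open>The value \<open>r + 1\<close> keeps the minimum meaningful when no point lies
    outside the ball.\<close>
  define m where "m = Min (insert (r + 1) ((\<lambda>i. dist x (xs i)) ` ?O))"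
  have m: "r < m" "\<And>i. i \<in> ?O \<Longrightarrow> m \<le> dist x (xs i)"
    using assms by (auto simp: m_def)
  have "dist x (xs i) \<le> r + (m - r) / 2 \<longleftrightarrow> dist x (xs i) \<le> r" if "i \<in> I" for i
    using m(1) m(2)[of i] that by (cases "dist x (xs i) \<le> r") (auto simp: field_simps)
  then have "trace_of I xs (cball x (r + (m - r) / 2)) = trace_of I xs (cball x r)"
    by (auto simp: trace_of_def)
  then show ?thesis using m(1) by (intro exI[of _ "(m - r) / 2"]) auto
qed

lemma rational_ball_superset_same_trace:
  fixes xs :: "'i \<Rightarrow> 'a::euclidean_space"
  assumes "finite I"
  shows "\<exists>B\<in>rational_balls. cball x r \<subseteq> B \<and> trace_of I xs B = trace_of I xs (cball x r)"
proof -
  obtain e where e: "e > 0" "trace_of I xs (cball x (r + e)) = trace_of I xs (cball x r)"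
    using cball_enlarge_same_trace[OF assms] by blast
  let ?D = "SOME D::'a set. countable D \<and> closure D = UNIV"
  have "x \<in> closure ?D" by (simp add: countable_dense_SOME)
  then obtain q where q: "q \<in> ?D" "dist q x < e / 3"
    using e(1) closure_approachable[THEN iffD1, OF \<open>x \<in> closure ?D\<close>, rule_format, of "e / 3"] by auto
  \<comment> \<open>The slack \<open>e\<close> is split in thirds: the centre moves by less than
    \<open>e / 3\<close>, so a radius above \<open>r + e / 3\<close> covers the old ball and one
    below \<open>r + 2 * e / 3\<close> stays inside the enlarged ball.\<close>
  obtain p where p: "p \<in> \<rat>" "r + e / 3 < p" "p < r + 2 * e / 3"
    using Rats_dense_in_real[of "r + e / 3" "r + 2 * e / 3"] e by auto
  have sub: "cball x r \<subseteq> cball q p" "cball q p \<subseteq> cball x (r + e)"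
    using q p by (auto simp: cball_subset_cball_iff dist_commute)
  then have "trace_of I xs (cball q p) = trace_of I xs (cball x r)"
    using e(2) unfolding trace_of_def by blast
  then show ?thesis
    using sub q p by (intro bexI[of _ "cball q p"]) (auto simp: rational_balls_def)
qed

section \<open>Balls of large mass contain many sample points\<close>

text \<open>Indices \<open>1..n\<close> carry the sample and \<open>n+1..2*n\<close> the ghost
  sample, with \<open>i + n\<close> the ghost of \<open>i\<close>. For \<open>A\<close> inside
  \<open>{1..n}\<close> this is the involution exchanging the pairs selected by
  \<open>A\<close>.\<close>

definition swap_index :: "nat \<Rightarrow> nat set \<Rightarrow> nat \<Rightarrow> nat" where
  "swap_index n A i = (if i \<in> A then i + n else if n < i \<and> i - n \<in> A then i - n else i)"

text \<open>For the trace \<open>T\<close> of a ball this is \<open>(2/3) ^ N * (4/3) ^ N'\<close>.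
  The form as a product over indices lets it factor over the pairs \<open>i\<close>,
  \<open>i + n\<close>.\<close>

definition ghost_weight :: "nat \<Rightarrow> nat set \<Rightarrow> real" where
  "ghost_weight n T = (\<Prod>i\<in>{1..n}. if i \<in> T then 2 / 3 else 1) *
     (\<Prod>i\<in>{n+1..2*n}. if i \<in> T then 4 / 3 else 1)"

lemma swap_index_bij:
  assumes "A \<subseteq> {1..n}"
  shows "inj_on (swap_index n A) {1..2*n}" and "swap_index n A \<in> {1..2*n} \<rightarrow> {1..2*n}"
proof -
  have self_inverse: "swap_index n A (swap_index n A i) = i" if "i \<in> {1..2*n}" for i
    using assms that by (auto simp: swap_index_def subset_iff)
  then show "inj_on (swap_index n A) {1..2*n}" by (rule inj_on_inverseI)
  show "swap_index n A \<in> {1..2*n} \<rightarrow> {1..2*n}"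
    using assms by (auto simp: swap_index_def subset_iff)
qed

text \<open>The bases \<open>2/3\<close> and \<open>4/3\<close> are chosen because they sum to \<open>2\<close> and have product at most \<open>1\<close>:
  swapping a uniformly random set of pairs then gives each pair a mean factor at most \<open>1\<close>.\<close>

lemma sum_ghost_weight_swaps_le:
  "(\<Sum>A\<in>Pow {1..n}. ghost_weight n {i \<in> {1..2*n}. swap_index n A i \<in> T}) \<le> 2 ^ n"
proof -
  define a :: "nat \<Rightarrow> real" where
    "a i = (if i + n \<in> T then 2 / 3 else 1) * (if i \<in> T then 4 / 3 else 1)" for i
  define b :: "nat \<Rightarrow> real" where
    "b i = (if i \<in> T then 2 / 3 else 1) * (if i + n \<in> T then 4 / 3 else 1)" for i
  have "ghost_weight n {i \<in> {1..2*n}. swap_index n A i \<in> T}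
      = (\<Prod>i\<in>A. a i) * (\<Prod>i\<in>{1..n} - A. b i)" if A: "A \<subseteq> {1..n}" for A
  proof -
    let ?T = "{i \<in> {1..2*n}. swap_index n A i \<in> T}"
    have "(\<Prod>i\<in>{n+1..2*n}. if i \<in> ?T then 4 / 3 else 1 :: real)
        = (\<Prod>i\<in>{1..n}. if i + n \<in> ?T then 4 / 3 else 1)"
      by (rule prod.reindex_bij_witness[of _ "\<lambda>i. i + n" "\<lambda>i. i - n"]) auto
    then have "ghost_weight n ?T
        = (\<Prod>i\<in>{1..n}. (if i \<in> ?T then 2 / 3 else 1) * (if i + n \<in> ?T then 4 / 3 else 1))"
      by (simp add: ghost_weight_def prod.distrib)
    also have "\<dots> = (\<Prod>i\<in>{1..n}. if i \<in> A then a i else b i)"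
      using A by (intro prod.cong) (auto simp: a_def b_def swap_index_def subset_iff)
    also have "\<dots> = (\<Prod>i\<in>A. a i) * (\<Prod>i\<in>{1..n} - A. b i)"
      using A by (simp add: prod.If_cases Int_absorb1 Diff_eq)
    finally show ?thesis .
  qed
  then have "(\<Sum>A\<in>Pow {1..n}. ghost_weight n {i \<in> {1..2*n}. swap_index n A i \<in> T})
      = (\<Sum>A\<in>Pow {1..n}. (\<Prod>i\<in>A. a i) * (\<Prod>i\<in>{1..n} - A. b i))"
    by (intro sum.cong) auto
  \<comment> \<open>Summing over all swap sets expands a product of sums: each pair independently
    contributes its swapped factor \<open>a i\<close> or its unswapped factor
    \<open>b i\<close>.\<close>
  also have "\<dots> = (\<Prod>i\<in>{1..n}. a i + b i)"
    by (rule prod_add[symmetric]) simp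
  \<comment> \<open>The sum \<open>a i + b i\<close> is 2 if none of the pair or exactly one of it
    lies in \<open>T\<close>, and 16/9 if both do.\<close>
  also have "\<dots> \<le> (\<Prod>i\<in>{1..n}. 2)"
    by (intro prod_mono) (auto simp: a_def b_def)
  finally show ?thesis by simp
qed

lemma ghost_weight_nonneg: "0 \<le> ghost_weight n T"
  unfolding ghost_weight_def by (intro mult_nonneg_nonneg prod_nonneg) auto

lemma measurable_ghost_weight:
  assumes "B \<in> sets P"
  shows "(\<lambda>z. ghost_weight n (trace_of {1..2*n} z B)) \<in> borel_measurable (PiM {1..2*n} (\<lambda>_. P))"
proof -
  have [measurable]: "B \<in> sets P" by fact
  have "(\<lambda>z. if i \<in> trace_of {1..2*n} z B then c else 1 :: real)
      \<in> borel_measurable (PiM {1..2*n} (\<lambda>_. P))" if "i \<in> {1..2*n}" for i c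
  proof -
    have [measurable]: "(\<lambda>z. z i) \<in> PiM {1..2*n} (\<lambda>_. P) \<rightarrow>\<^sub>M P"
      using that by (rule measurable_component_singleton)
    have "(\<lambda>z. if z i \<in> B then c else 1 :: real) \<in> borel_measurable (PiM {1..2*n} (\<lambda>_. P))"
      by measurable
    then show ?thesis using that by (simp add: trace_of_def)
  qed
  then show ?thesis
    unfolding ghost_weight_def by (intro borel_measurable_times borel_measurable_prod) auto
qed

text \<open>The product law is invariant under swaps, so the integral equals its average over all
  \<open>2 ^ n\<close> swap sets. That average is bounded pointwise, with the double sample held
  fixed.\<close>

lemma nn_integral_SUP_ghost_weight_le:
  fixes P :: "'a measure" and s :: nat
  assumes P: "prob_space P" and Bs: "countable Bs" "Bs \<subseteq> sets P"
    and s: "\<And>x. card (trace_of {1..2*n} x ` Bs) \<le> s"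
  shows "(\<integral>\<^sup>+ z. (SUP B\<in>Bs. ennreal (ghost_weight n (trace_of {1..2*n} z B)))
            \<partial>PiM {1..2*n} (\<lambda>_. P)) \<le> ennreal (real s)"
proof -
  let ?K = "{1..2*n}" and ?PP = "PiM {1..2*n} (\<lambda>_. P)"
  define F where "F z = (SUP B\<in>Bs. ennreal (ghost_weight n (trace_of ?K z B)))" for z
  have F_meas: "F \<in> borel_measurable ?PP"
    unfolding F_def using Bs measurable_ghost_weight[of _ P n]
    by (intro borel_measurable_SUP) (auto intro: measurable_compose[OF _ measurable_ennreal])
  define R where "R A z = (\<lambda>i\<in>?K. z (swap_index n A i))" for A and z :: "nat \<Rightarrow> 'a"
  have R_meas[measurable]: "R A \<in> ?PP \<rightarrow>\<^sub>M ?PP" if "A \<subseteq> {1..n}" for A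
    unfolding R_def using swap_index_bij(2)[OF that]
    by (intro measurable_restrict measurable_component_singleton) auto
  have inv: "(\<integral>\<^sup>+ z. F (R A z) \<partial>?PP) = (\<integral>\<^sup>+ z. F z \<partial>?PP)" if "A \<subseteq> {1..n}" for A
  proof -
    have "distr ?PP ?PP (R A) = ?PP"
      unfolding R_def using distr_PiM_reindex[OF _ swap_index_bij[OF that], of "\<lambda>_. P"] P by simp
    then have "(\<integral>\<^sup>+ z. F z \<partial>?PP) = (\<integral>\<^sup>+ z. F z \<partial>distr ?PP ?PP (R A))" by simp
    also have "\<dots> = (\<integral>\<^sup>+ z. F (R A z) \<partial>?PP)"
      using F_meas by (intro nn_integral_distr R_meas that) (simp del: One_nat_def)
    finally show ?thesis by simp
  qed
  have pointwise: "(\<Sum>A\<in>Pow {1..n}. F (R A z)) \<le> ennreal (2 ^ n * real s)" for z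
  proof -
    let ?Tr = "trace_of ?K z ` Bs"
    let ?w = "\<lambda>A T. ghost_weight n {i \<in> ?K. swap_index n A i \<in> T}"
    have fin: "finite ?Tr" by (rule finite_subset[of _ "Pow ?K"]) (auto simp: trace_of_def)
    \<comment> \<open>The traces are those of the unswapped \<open>z\<close>, so one finite set of
      at most \<open>s\<close> traces serves every \<open>A\<close>. This permits exchanging the two
      sums below.\<close>
    have "F (R A z) \<le> ennreal (\<Sum>T\<in>?Tr. ?w A T)" if "A \<subseteq> {1..n}" for A
      unfolding F_def
    proof (rule SUP_least)
      fix B assume "B \<in> Bs"
      have "trace_of ?K (R A z) B = {i \<in> ?K. swap_index n A i \<in> trace_of ?K z B}"
        using swap_index_bij(2)[OF that] by (auto simp: trace_of_def R_def)
      then have "ghost_weight n (trace_of ?K (R A z) B) = ?w A (trace_of ?K z B)" by simp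
      also have "\<dots> \<le> (\<Sum>T\<in>?Tr. ?w A T)"
        using fin \<open>B \<in> Bs\<close> by (intro member_le_sum) (auto simp: ghost_weight_nonneg)
      finally show "ennreal (ghost_weight n (trace_of ?K (R A z) B)) \<le> ennreal (\<Sum>T\<in>?Tr. ?w A T)"
        by (rule ennreal_leI)
    qed
    then have "(\<Sum>A\<in>Pow {1..n}. F (R A z)) \<le> (\<Sum>A\<in>Pow {1..n}. ennreal (\<Sum>T\<in>?Tr. ?w A T))"
      by (intro sum_mono) auto
    also have "\<dots> = ennreal (\<Sum>A\<in>Pow {1..n}. \<Sum>T\<in>?Tr. ?w A T)"
      by (intro sum_ennreal sum_nonneg ghost_weight_nonneg)
    also have "(\<Sum>A\<in>Pow {1..n}. \<Sum>T\<in>?Tr. ?w A T) = (\<Sum>T\<in>?Tr. \<Sum>A\<in>Pow {1..n}. ?w A T)"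
      by (rule sum.swap)
    also have "\<dots> \<le> (\<Sum>T\<in>?Tr. 2 ^ n)"
      by (intro sum_mono sum_ghost_weight_swaps_le)
    also have "\<dots> \<le> 2 ^ n * real s"
      using s[of z] by simp
    finally show ?thesis by (simp add: ennreal_leI)
  qed
  have "ennreal (2 ^ n) * (\<integral>\<^sup>+ z. F z \<partial>?PP) = (\<Sum>A\<in>Pow {1..n}. \<integral>\<^sup>+ z. F z \<partial>?PP)"
    by (simp add: card_Pow flip: ennreal_power)
  also have "\<dots> = (\<Sum>A\<in>Pow {1..n}. \<integral>\<^sup>+ z. F (R A z) \<partial>?PP)"
    using inv by (intro sum.cong) auto
  also have "\<dots> = (\<integral>\<^sup>+ z. (\<Sum>A\<in>Pow {1..n}. F (R A z)) \<partial>?PP)"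
    by (intro nn_integral_sum[symmetric] measurable_compose[OF R_meas F_meas]) (rule PowD)
  also have "\<dots> \<le> (\<integral>\<^sup>+ z. ennreal (2 ^ n * real s) \<partial>?PP)"
    by (intro nn_integral_mono pointwise)
  also have "\<dots> = ennreal (2 ^ n) * ennreal (real s)"
    using prob_space.emeasure_space_1[OF prob_space_PiM, of ?K "\<lambda>_. P"] P by (simp add: ennreal_mult)
  finally show ?thesis
    unfolding F_def[symmetric] by (subst (asm) ennreal_mult_le_mult_iff) auto
qed

section \<open>Lower deviations of the counts in balls of large mass\<close>

text \<open>By convexity, the exponential lies below its chord between \<open>p = 0\<close> and
  \<open>p = 1\<close>. The right side is the mean of one ghost factor for a ball of mass
  \<open>p\<close>.\<close>

lemma powr_le_one_plus:
  fixes p :: real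
  assumes "0 \<le> p" "p \<le> 1"
  shows "(4 / 3) powr p \<le> 1 + p / 3"
proof -
  have "exp ((1 - p) *\<^sub>R 0 + p *\<^sub>R ln (4 / 3)) \<le> (1 - p) * exp 0 + p * exp (ln (4 / 3 :: real))"
    using assms by (intro convex_onD[OF exp_convex]) auto
  then show ?thesis by (simp add: powr_def algebra_simps)
qed

lemma sets_sparse_heavy_set:
  fixes P :: "'a measure"
  assumes I: "finite I" and Bs: "countable Bs" "Bs \<subseteq> sets P"
  shows "{x \<in> space (PiM I (\<lambda>_. P)). \<exists>B\<in>Bs. a \<le> b * measure P B \<and> card (trace_of I x B) < k}
    \<in> sets (PiM I (\<lambda>_. P))" (is "?E \<in> _")
proof -
  have "{x \<in> space (PiM I (\<lambda>_. P)). card (trace_of I x B) < k} \<in> sets (PiM I (\<lambda>_. P))"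
    if "B \<in> Bs" for B
  proof -
    have [measurable]: "B \<in> sets P" using that Bs by auto
    have "card (trace_of I x B) = (\<Sum>i\<in>I. if x i \<in> B then 1 else 0)" for x
      using I by (simp add: trace_of_def sum.If_cases Int_def)
    then show ?thesis by simp
  qed
  moreover have "?E = (\<Union>B\<in>{B \<in> Bs. a \<le> b * measure P B}.
      {x \<in> space (PiM I (\<lambda>_. P)). card (trace_of I x B) < k})"
    by auto
  ultimately show ?thesis using Bs by (auto intro!: sets.countable_UN')
qed

text \<open>On the exceptional event the integral over the ghost points alone is at least
  \<open>(32/27) ^ k\<close>, while the full integral is at most \<open>s\<close>; this is Markov's
  inequality after Fubini.\<close>

lemma prob_sparse_heavy_set_le:
  fixes P :: "'a measure" and n k s :: nat
  assumes P: "prob_space P" and Bs: "countable Bs" "Bs \<subseteq> sets P"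
    and s: "\<And>x. card (trace_of {1..2*n} x ` Bs) \<le> s"
  shows "measure (PiM {1..n} (\<lambda>_. P)) {x \<in> space (PiM {1..n} (\<lambda>_. P)).
      \<exists>B\<in>Bs. 2 * real k \<le> real n * measure P B \<and> card (trace_of {1..n} x B) < k}
    \<le> real s * exp (- real k / 8)"
proof -
  interpret P: prob_space P by fact
  interpret PS: product_sigma_finite "\<lambda>_::nat. P" by standard
  let ?I = "{1..n}" and ?J = "{n+1..2*n}" and ?K = "{1..2*n}"
  let ?PI = "PiM ?I (\<lambda>_. P)" and ?PJ = "PiM ?J (\<lambda>_. P)" and ?PK = "PiM ?K (\<lambda>_. P)"
  interpret PI: prob_space ?PI by (rule prob_space_PiM) (rule P)
  have K: "?I \<union> ?J = ?K" "?I \<inter> ?J = {}" by auto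
  define F where "F z = (SUP B\<in>Bs. ennreal (ghost_weight n (trace_of ?K z B)))" for z
  have F_meas: "F \<in> borel_measurable ?PK"
    unfolding F_def using Bs measurable_ghost_weight[of _ P n]
    by (intro borel_measurable_SUP) (auto intro: measurable_compose[OF _ measurable_ennreal])
  define E where "E = {x \<in> space ?PI.
      \<exists>B\<in>Bs. 2 * real k \<le> real n * measure P B \<and> card (trace_of ?I x B) < k}"
  have E_meas: "E \<in> sets ?PI"
    unfolding E_def using Bs by (intro sets_sparse_heavy_set) auto
  have lower: "ennreal ((32 / 27) ^ k) \<le> (\<integral>\<^sup>+ y. F (merge ?I ?J (x, y)) \<partial>?PJ)" if "x \<in> E" for x
  proof -
    obtain B where B: "B \<in> Bs" "2 * real k \<le> real n * measure P B" "card (trace_of ?I x B) < k"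
      using \<open>x \<in> E\<close> by (auto simp: E_def)
    then have [measurable]: "B \<in> sets P" using Bs by auto
    define p where "p = measure P B"
    have weight: "ghost_weight n (trace_of ?K (merge ?I ?J (x, y)) B)
        = (2 / 3) ^ card (trace_of ?I x B) * (\<Prod>i\<in>?J. if y i \<in> B then 4 / 3 else 1)" for y
    proof -
      have "(\<Prod>i\<in>?I. if i \<in> trace_of ?K (merge ?I ?J (x, y)) B then 2 / 3 else 1 :: real)
          = (\<Prod>i\<in>?I. if x i \<in> B then 2 / 3 else 1)"
        by (intro prod.cong) (auto simp: trace_of_def merge_def)
      also have "\<dots> = (2 / 3) ^ card (trace_of ?I x B)"
        by (simp add: prod.If_cases trace_of_def Int_def)
      finally have "(\<Prod>i\<in>?I. if i \<in> trace_of ?K (merge ?I ?J (x, y)) B then 2 / 3 else 1 :: real)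
          = (2 / 3) ^ card (trace_of ?I x B)" .
      moreover have "(\<Prod>i\<in>?J. if i \<in> trace_of ?K (merge ?I ?J (x, y)) B then 4 / 3 else 1 :: real)
          = (\<Prod>i\<in>?J. if y i \<in> B then 4 / 3 else 1)"
        by (intro prod.cong) (auto simp: trace_of_def merge_def)
      ultimately show ?thesis unfolding ghost_weight_def by simp
    qed
    have one: "(\<integral>\<^sup>+ u. ennreal (if u \<in> B then 4 / 3 else 1) \<partial>P) = ennreal (1 + p / 3)"
    proof -
      have "ennreal (4 / 3) = ennreal (1 / 3) + 1"
        using ennreal_plus[of "1 / 3" 1] by simp
      then have "(\<integral>\<^sup>+ u. ennreal (if u \<in> B then 4 / 3 else 1) \<partial>P)
          = (\<integral>\<^sup>+ u. ennreal (1 / 3) * indicator B u + 1 \<partial>P)"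
        by (intro nn_integral_cong) (auto simp: indicator_def)
      also have "\<dots> = ennreal (1 / 3) * emeasure P B + 1"
        by (simp add: nn_integral_add nn_integral_cmult P.emeasure_space_1)
      also have "\<dots> = ennreal (1 + p / 3)"
        by (simp add: P.emeasure_eq_measure p_def add.commute flip: ennreal_plus ennreal_mult ennreal_1)
      finally show ?thesis .
    qed
    have "(4 / 3 :: real) powr (2 * real k) = (16 / 9) ^ k"
      using powr_realpow[of "4 / 3" "2 * k"] by (simp add: power_mult power2_eq_square)
    then have "(32 / 27) ^ k = (2 / 3 :: real) ^ k * (4 / 3) powr (2 * real k)"
      by (simp flip: power_mult_distrib)
    \<comment> \<open>The base below one uses that the sample count is less than \<open>k\<close>,
      the base above one that \<open>n * p\<close> is at least \<open>2 * k\<close>.\<close>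
    also have "\<dots> \<le> (2 / 3) ^ card (trace_of ?I x B) * (4 / 3) powr (real n * p)"
      using B by (intro mult_mono[OF power_decreasing powr_mono]) (auto simp: p_def)
    also have "(4 / 3) powr (real n * p) = ((4 / 3) powr p) ^ n"
      by (simp add: powr_powr mult.commute flip: powr_realpow)
    also have "\<dots> \<le> (1 + p / 3) ^ n"
      by (intro power_mono powr_le_one_plus) (auto simp: p_def)
    finally have "(32 / 27) ^ k \<le> (2 / 3) ^ card (trace_of ?I x B) * (1 + p / 3) ^ n"
      by (simp add: mult_left_mono)
    then have "ennreal ((32 / 27) ^ k) \<le> ennreal ((2 / 3) ^ card (trace_of ?I x B) * (1 + p / 3) ^ n)"
      by (rule ennreal_leI)
    also have "\<dots> = ennreal ((2 / 3) ^ card (trace_of ?I x B)) * ennreal ((1 + p / 3) ^ n)"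
      by (rule ennreal_mult) (auto simp: p_def)
    also have "ennreal ((1 + p / 3) ^ n) = (\<Prod>i\<in>?J. ennreal (1 + p / 3))"
      by (simp add: ennreal_power[symmetric] p_def del: ennreal_plus)
    also have "\<dots> = (\<integral>\<^sup>+ y. (\<Prod>i\<in>?J. ennreal (if y i \<in> B then 4 / 3 else 1)) \<partial>?PJ)"
      unfolding one[symmetric] by (subst PS.product_nn_integral_prod) auto
    also have "ennreal ((2 / 3) ^ card (trace_of ?I x B))
        * (\<integral>\<^sup>+ y. (\<Prod>i\<in>?J. ennreal (if y i \<in> B then 4 / 3 else 1)) \<partial>?PJ)
      = (\<integral>\<^sup>+ y. ennreal ((2 / 3) ^ card (trace_of ?I x B))
        * (\<Prod>i\<in>?J. ennreal (if y i \<in> B then 4 / 3 else 1)) \<partial>?PJ)"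
      by (rule nn_integral_cmult[symmetric]) measurable
    also have "\<dots> = (\<integral>\<^sup>+ y. ennreal (ghost_weight n (trace_of ?K (merge ?I ?J (x, y)) B)) \<partial>?PJ)"
      unfolding weight by (simp add: prod_ennreal prod_nonneg ennreal_mult)
    also have "\<dots> \<le> (\<integral>\<^sup>+ y. F (merge ?I ?J (x, y)) \<partial>?PJ)"
      unfolding F_def by (intro nn_integral_mono SUP_upper B)
    finally show ?thesis .
  qed
  have "ennreal ((32 / 27) ^ k) * emeasure ?PI E = (\<integral>\<^sup>+ x. ennreal ((32 / 27) ^ k) * indicator E x \<partial>?PI)"
    using E_meas by (simp add: nn_integral_cmult_indicator)
  also have "\<dots> \<le> (\<integral>\<^sup>+ x. (\<integral>\<^sup>+ y. F (merge ?I ?J (x, y)) \<partial>?PJ) \<partial>?PI)"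
    using lower by (intro nn_integral_mono) (auto simp: indicator_def)
  also have "\<dots> = (\<integral>\<^sup>+ z. F z \<partial>?PK)"
    using PS.product_nn_integral_fold[of ?I ?J F] F_meas K by simp
  also have "\<dots> \<le> ennreal (real s)"
    unfolding F_def by (rule nn_integral_SUP_ghost_weight_le[OF P Bs s])
  finally have "(32 / 27) ^ k * measure ?PI E \<le> real s"
    by (simp add: PI.emeasure_eq_measure del: One_nat_def flip: ennreal_mult)
  then have "measure ?PI E \<le> real s * (27 / 32) ^ k"
    by (simp add: power_divide field_simps)
  \<comment> \<open>Since \<open>exp (- 1 / 8)\<close> is at least \<open>1 - 1/8 = 28/32\<close>,
    it exceeds 27/32.\<close>
  also have "\<dots> \<le> real s * exp (- 1 / 8) ^ k"
    using exp_ge_add_one_self[of "- 1 / 8 :: real"] by (intro mult_left_mono power_mono) auto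
  also have "exp (- 1 / 8 :: real) ^ k = exp (- real k / 8)"
    by (simp flip: exp_of_nat_mult)
  finally show ?thesis unfolding E_def .
qed

section \<open>Uniform control of the noise\<close>

text \<open>Hypothesis \<open>contr\<close> expresses that \<open>w\<close> has conditional mean at
  most one given \<open>f\<close>. By Fubini the factors are dropped one coordinate at a time, as
  \<open>H\<close> sees the coordinates only through \<open>f\<close>.\<close>

lemma nn_integral_restrict_prod_le:
  fixes Q :: "'z measure" and N :: "'a measure" and w :: "'z \<Rightarrow> ennreal"
  assumes Q: "prob_space Q" and f[measurable]: "f \<in> Q \<rightarrow>\<^sub>M N" and w[measurable]: "w \<in> borel_measurable Q"
    and contr: "\<And>h. h \<in> borel_measurable N \<Longrightarrow> (\<integral>\<^sup>+ z. h (f z) * w z \<partial>Q) \<le> (\<integral>\<^sup>+ z. h (f z) \<partial>Q)"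
    and I: "finite I" and H: "H \<in> borel_measurable (PiM I (\<lambda>_. N))" and A: "A \<subseteq> I"
  shows "(\<integral>\<^sup>+ z. H (\<lambda>i\<in>I. f (z i)) * (\<Prod>i\<in>A. w (z i)) \<partial>PiM I (\<lambda>_. Q))
    \<le> (\<integral>\<^sup>+ z. H (\<lambda>i\<in>I. f (z i)) \<partial>PiM I (\<lambda>_. Q))"
proof -
  interpret Q: prob_space Q by fact
  interpret PS: product_sigma_finite "\<lambda>_. Q" by standard
  have "finite A" using A I finite_subset by auto
  then show ?thesis using A
  proof (induction A rule: finite_induct)
    case (insert i A)
    define I' where "I' = I - {i}"
    have I': "I = insert i I'" "finite I'" "i \<notin> I'" "A \<subseteq> I'"
      using insert I by (auto simp: I'_def)
    have comp: "(\<lambda>z. z j) \<in> PiM I (\<lambda>_. Q) \<rightarrow>\<^sub>M Q" if "j \<in> I" for j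
      using that by (rule measurable_component_singleton)
    have restr: "(\<lambda>z. \<lambda>j\<in>I. f (z j)) \<in> PiM I (\<lambda>_. Q) \<rightarrow>\<^sub>M PiM I (\<lambda>_. N)"
      by (intro measurable_restrict measurable_compose[OF comp f])
    have HF: "(\<lambda>z. H (\<lambda>j\<in>I. f (z j))) \<in> borel_measurable (PiM I (\<lambda>_. Q))"
      by (rule measurable_compose[OF restr H])
    have W: "(\<lambda>z. \<Prod>j\<in>B. w (z j)) \<in> borel_measurable (PiM I (\<lambda>_. Q))" if "B \<subseteq> I" for B
      using that by (intro borel_measurable_prod_ennreal measurable_compose[OF comp w]) auto
    have inner: "(\<integral>\<^sup>+ y. H (\<lambda>j\<in>I. f ((x(i := y)) j)) * (\<Prod>j\<in>insert i A. w ((x(i := y)) j)) \<partial>Q)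
        \<le> (\<integral>\<^sup>+ y. H (\<lambda>j\<in>I. f ((x(i := y)) j)) * (\<Prod>j\<in>A. w ((x(i := y)) j)) \<partial>Q)"
      if x: "x \<in> space (PiM I' (\<lambda>_. Q))" for x
    proof -
      let ?c = "\<Prod>j\<in>A. w (x j)"
      let ?x = "\<lambda>j\<in>I'. f (x j)"
      \<comment> \<open>With the other coordinates frozen, \<open>H\<close> depends on
        \<open>y\<close> only through \<open>f y\<close>, and the remaining weights are a constant
        \<open>?c\<close>; so \<open>h\<close> is a legitimate test function for
        \<open>contr\<close>.\<close>
      define h where "h u = H (?x(i := u)) * ?c" for u
      have "?x \<in> space (PiM I' (\<lambda>_. N))"
        using x measurable_space[OF f] by (auto simp: space_PiM PiE_iff)
      then have "(\<lambda>u. ?x(i := u)) \<in> N \<rightarrow>\<^sub>M PiM I (\<lambda>_. N)"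
        unfolding I'(1) using I'(3) by (rule measurable_component_update)
      then have h: "h \<in> borel_measurable N"
        unfolding h_def by (intro borel_measurable_times_ennreal measurable_compose[OF _ H]) auto
      have 1: "(\<lambda>j\<in>I. f ((x(i := y)) j)) = ?x(i := f y)" for y
        using I' by (auto simp: fun_eq_iff restrict_def)
      have 2: "(\<Prod>j\<in>A. w ((x(i := y)) j)) = ?c" for y
        using insert.hyps by (intro prod.cong) auto
      have 3: "(\<Prod>j\<in>insert i A. w ((x(i := y)) j)) = w y * ?c" for y
        using insert.hyps 2[of y] by simp
      have "(\<integral>\<^sup>+ y. h (f y) * w y \<partial>Q) \<le> (\<integral>\<^sup>+ y. h (f y) \<partial>Q)"
        by (rule contr[OF h])
      then show ?thesis unfolding 1 2 3 h_def by (simp add: mult_ac)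
    qed
    have "(\<integral>\<^sup>+ z. H (\<lambda>j\<in>I. f (z j)) * (\<Prod>j\<in>insert i A. w (z j)) \<partial>PiM I (\<lambda>_. Q))
        = (\<integral>\<^sup>+ x. \<integral>\<^sup>+ y. H (\<lambda>j\<in>I. f ((x(i := y)) j)) * (\<Prod>j\<in>insert i A. w ((x(i := y)) j)) \<partial>Q
            \<partial>PiM I' (\<lambda>_. Q))"
      using PS.product_nn_integral_insert[OF I'(2,3), folded I'(1),
        OF borel_measurable_times_ennreal[OF HF W[OF insert.prems]]] .
    also have "\<dots> \<le> (\<integral>\<^sup>+ x. \<integral>\<^sup>+ y. H (\<lambda>j\<in>I. f ((x(i := y)) j)) * (\<Prod>j\<in>A. w ((x(i := y)) j)) \<partial>Q
            \<partial>PiM I' (\<lambda>_. Q))"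
      by (intro nn_integral_mono inner)
    also have "\<dots> = (\<integral>\<^sup>+ z. H (\<lambda>j\<in>I. f (z j)) * (\<Prod>j\<in>A. w (z j)) \<partial>PiM I (\<lambda>_. Q))"
      using PS.product_nn_integral_insert[OF I'(2,3), folded I'(1),
        OF borel_measurable_times_ennreal[OF HF W]] insert.prems by simp
    also have "\<dots> \<le> (\<integral>\<^sup>+ z. H (\<lambda>i\<in>I. f (z i)) \<partial>PiM I (\<lambda>_. Q))"
      using insert.prems by (intro insert.IH) auto
    finally show ?case .
  qed simp
qed

lemma sets_trace_of_eq:
  assumes "finite I" and B: "B \<in> sets N"
  shows "{x \<in> space (PiM I (\<lambda>_. N)). trace_of I x B = A} \<in> sets (PiM I (\<lambda>_. N))"
proof (cases "A \<subseteq> I")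
  case True
  have "{x \<in> space (PiM I (\<lambda>_. N)). x i \<in> B \<longleftrightarrow> i \<in> A} \<in> sets (PiM I (\<lambda>_. N))" if "i \<in> I" for i
  proof -
    have [measurable]: "(\<lambda>x. x i) \<in> PiM I (\<lambda>_. N) \<rightarrow>\<^sub>M N"
      using that by (rule measurable_component_singleton)
    show ?thesis using B by measurable
  qed
  then have "{x \<in> space (PiM I (\<lambda>_. N)). \<forall>i\<in>I. x i \<in> B \<longleftrightarrow> i \<in> A} \<in> sets (PiM I (\<lambda>_. N))"
    using assms(1) by (intro sets.sets_Collect_finite_All) auto
  moreover have "trace_of I x B = A \<longleftrightarrow> (\<forall>i\<in>I. x i \<in> B \<longleftrightarrow> i \<in> A)" for x
    using True by (auto simp: trace_of_def)
  ultimately show ?thesis by simp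
next
  case False
  then have "{x \<in> space (PiM I (\<lambda>_. N)). trace_of I x B = A} = {}" by (auto simp: trace_of_def)
  then show ?thesis by (metis sets.empty_sets)
qed

text \<open>Given the design points only the trace of \<open>B\<close> matters, so the supremum over the class is at
  most a sum over its traces; each summand is then integrated out one response at a time.\<close>

lemma nn_integral_SUP_prod_trace_le:
  fixes Q :: "'z measure" and N :: "'a measure" and w :: "'z \<Rightarrow> ennreal" and I :: "'i set"
  assumes Q: "prob_space Q" and f: "f \<in> Q \<rightarrow>\<^sub>M N" and w: "w \<in> borel_measurable Q"
    and contr: "\<And>h. h \<in> borel_measurable N \<Longrightarrow> (\<integral>\<^sup>+ z. h (f z) * w z \<partial>Q) \<le> (\<integral>\<^sup>+ z. h (f z) \<partial>Q)"
    and I: "finite I" and Bs: "countable Bs" "Bs \<subseteq> sets N"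
    and s: "\<And>x. card (trace_of I x ` Bs) \<le> s"
  shows "(\<integral>\<^sup>+ z. (SUP B\<in>Bs. \<Prod>i\<in>trace_of I (\<lambda>i. f (z i)) B. w (z i)) \<partial>PiM I (\<lambda>_. Q)) \<le> of_nat s"
proof -
  interpret PI: prob_space "PiM I (\<lambda>_. Q)" by (rule prob_space_PiM) (rule Q)
  \<comment> \<open>The event that \<open>A\<close> is a trace depends only on the design points, so
    its indicator can play the role of \<open>H\<close> when the weights are integrated out.\<close>
  define D where "D A = {x \<in> space (PiM I (\<lambda>_. N)). \<exists>B\<in>Bs. trace_of I x B = A}" for A
  have "D A = (\<Union>B\<in>Bs. {x \<in> space (PiM I (\<lambda>_. N)). trace_of I x B = A})" for A
    by (auto simp: D_def)
  then have D: "D A \<in> sets (PiM I (\<lambda>_. N))" for A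
    using Bs I by (auto intro!: sets.countable_UN' sets_trace_of_eq)
  have comp: "(\<lambda>z. z j) \<in> PiM I (\<lambda>_. Q) \<rightarrow>\<^sub>M Q" if "j \<in> I" for j
    using that by (rule measurable_component_singleton)
  define R where "R z = (\<lambda>i\<in>I. f (z i))" for z
  have R: "R \<in> PiM I (\<lambda>_. Q) \<rightarrow>\<^sub>M PiM I (\<lambda>_. N)"
    unfolding R_def by (intro measurable_restrict measurable_compose[OF comp f])
  have trace_R: "trace_of I (R z) B = trace_of I (\<lambda>i. f (z i)) B" for z B
    by (auto simp: trace_of_def R_def)
  have ind: "(\<lambda>z. indicator (D A) (R z) :: ennreal) \<in> borel_measurable (PiM I (\<lambda>_. Q))" for A
    by (intro measurable_compose[OF R] borel_measurable_indicator D)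
  have W: "(\<lambda>z. \<Prod>j\<in>A. w (z j)) \<in> borel_measurable (PiM I (\<lambda>_. Q))" if "A \<subseteq> I" for A
    using that by (intro borel_measurable_prod_ennreal measurable_compose[OF comp w]) auto
  have RD: "indicator (D (trace_of I (\<lambda>i. f (z i)) B)) (R z) = (1 :: ennreal)"
    if "B \<in> Bs" "z \<in> space (PiM I (\<lambda>_. Q))" for z B
  proof -
    have "R z \<in> D (trace_of I (\<lambda>i. f (z i)) B)"
      using that measurable_space[OF R] trace_R[of z B] unfolding D_def by blast
    then show ?thesis by simp
  qed
  have "(\<integral>\<^sup>+ z. (SUP B\<in>Bs. \<Prod>i\<in>trace_of I (\<lambda>i. f (z i)) B. w (z i)) \<partial>PiM I (\<lambda>_. Q))
      \<le> (\<integral>\<^sup>+ z. (\<Sum>A\<in>Pow I. indicator (D A) (R z) * (\<Prod>i\<in>A. w (z i))) \<partial>PiM I (\<lambda>_. Q))"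
  proof (intro nn_integral_mono SUP_least)
    fix z B assume z: "z \<in> space (PiM I (\<lambda>_. Q))" and B: "B \<in> Bs"
    let ?A = "trace_of I (\<lambda>i. f (z i)) B"
    have "(\<Prod>i\<in>?A. w (z i)) = indicator (D ?A) (R z) * (\<Prod>i\<in>?A. w (z i))"
      using RD[OF B z] by simp
    also have "\<dots> \<le> (\<Sum>A\<in>Pow I. indicator (D A) (R z) * (\<Prod>i\<in>A. w (z i)))"
      using I by (intro member_le_sum) (auto simp: trace_of_def)
    finally show "(\<Prod>i\<in>?A. w (z i)) \<le> (\<Sum>A\<in>Pow I. indicator (D A) (R z) * (\<Prod>i\<in>A. w (z i)))" .
  qed
  also have "\<dots> = (\<Sum>A\<in>Pow I. \<integral>\<^sup>+ z. indicator (D A) (R z) * (\<Prod>i\<in>A. w (z i)) \<partial>PiM I (\<lambda>_. Q))"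
    by (intro nn_integral_sum borel_measurable_times_ennreal ind W) auto
  also have "\<dots> \<le> (\<Sum>A\<in>Pow I. \<integral>\<^sup>+ z. indicator (D A) (R z) \<partial>PiM I (\<lambda>_. Q))"
    unfolding R_def
    by (intro sum_mono nn_integral_restrict_prod_le[OF Q f w contr I] borel_measurable_indicator D) auto
  also have "\<dots> = (\<integral>\<^sup>+ z. (\<Sum>A\<in>Pow I. indicator (D A) (R z)) \<partial>PiM I (\<lambda>_. Q))"
    by (intro nn_integral_sum[symmetric] ind)
  also have "\<dots> \<le> (\<integral>\<^sup>+ z. of_nat s \<partial>PiM I (\<lambda>_. Q))"
  proof (intro nn_integral_mono)
    fix z
    let ?Tr = "trace_of I (R z) ` Bs"
    have Tr: "?Tr \<subseteq> Pow I" by (auto simp: trace_of_def)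
    \<comment> \<open>For each design the sets \<open>A\<close> with \<open>R z\<close> in
      \<open>D A\<close> are traces of that design, hence at most \<open>s\<close> many.\<close>
    have "(\<Sum>A\<in>Pow I. indicator (D A) (R z)) \<le> (\<Sum>A\<in>Pow I. indicator ?Tr A :: ennreal)"
      by (intro sum_mono) (auto simp: D_def indicator_def)
    also have "\<dots> = of_nat (card ?Tr)"
      using I Tr by (simp add: sum.If_cases indicator_def Int_absorb1)
    also have "\<dots> \<le> of_nat s" using s[of "R z"] by simp
    finally show "(\<Sum>A\<in>Pow I. indicator (D A) (R z)) \<le> (of_nat s :: ennreal)" .
  qed
  also have "\<dots> = of_nat s" by (simp add: PI.emeasure_space_1)
  finally show ?thesis .
qed

section \<open>Exponential Markov bound simultaneously over all balls\<close>

lemma sets_trace_sum_large: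
  fixes e :: "'z \<Rightarrow> real" and c :: real
  assumes f: "f \<in> Q \<rightarrow>\<^sub>M N" and e: "e \<in> borel_measurable Q"
    and I: "finite I" and Bs: "countable Bs" "Bs \<subseteq> sets N"
  shows "{z \<in> space (PiM I (\<lambda>_. Q)). \<exists>B\<in>Bs. k \<le> card (trace_of I (\<lambda>i. f (z i)) B) \<and>
      real (card (trace_of I (\<lambda>i. f (z i)) B)) * c < (\<Sum>i\<in>trace_of I (\<lambda>i. f (z i)) B. e (z i))}
    \<in> sets (PiM I (\<lambda>_. Q))" (is "?E \<in> _")
proof -
  let ?P = "\<lambda>B z. k \<le> card (trace_of I (\<lambda>i. f (z i)) B) \<and>
      real (card (trace_of I (\<lambda>i. f (z i)) B)) * c < (\<Sum>i\<in>trace_of I (\<lambda>i. f (z i)) B. e (z i))"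
  have "{z \<in> space (PiM I (\<lambda>_. Q)). ?P B z} \<in> sets (PiM I (\<lambda>_. Q))" if "B \<in> Bs" for B
  proof -
    have B[measurable]: "B \<in> sets N" using that Bs by auto
    have comp: "(\<lambda>z. z i) \<in> PiM I (\<lambda>_. Q) \<rightarrow>\<^sub>M Q" if "i \<in> I" for i
      using that by (rule measurable_component_singleton)
    have fi[measurable]: "(\<lambda>z. f (z i)) \<in> PiM I (\<lambda>_. Q) \<rightarrow>\<^sub>M N" if "i \<in> I" for i
      by (rule measurable_compose[OF comp[OF that] f])
    have ei[measurable]: "(\<lambda>z. e (z i)) \<in> borel_measurable (PiM I (\<lambda>_. Q))" if "i \<in> I" for i
      by (rule measurable_compose[OF comp[OF that] e])
    have 1: "card (trace_of I (\<lambda>i. f (z i)) B) = (\<Sum>i\<in>I. if f (z i) \<in> B then 1 else 0)" for z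
      using I by (simp add: trace_of_def sum.If_cases Int_def)
    have 2: "(\<Sum>i\<in>trace_of I (\<lambda>i. f (z i)) B. e (z i)) = (\<Sum>i\<in>I. if f (z i) \<in> B then e (z i) else 0)" for z
      using I by (simp add: trace_of_def sum.If_cases Int_def)
    show ?thesis unfolding 1 2 by measurable
  qed
  moreover have "?E = (\<Union>B\<in>Bs. {z \<in> space (PiM I (\<lambda>_. Q)). ?P B z})" by auto
  ultimately show ?thesis using Bs by (auto intro!: sets.countable_UN')
qed

lemma prob_trace_sum_large_le_pos:
  fixes Q :: "'z measure" and N :: "'a measure" and e :: "'z \<Rightarrow> real" and I :: "'i set"
    and v \<delta> :: real and k s :: nat
  assumes Q: "prob_space Q" and f: "f \<in> Q \<rightarrow>\<^sub>M N" and e: "e \<in> borel_measurable Q"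
    and sub_gaussian: "\<And>t h. h \<in> borel_measurable N \<Longrightarrow>
      (\<integral>\<^sup>+ z. h (f z) * ennreal (exp (t * e z)) \<partial>Q) \<le> ennreal (exp (t\<^sup>2 * v / 2)) * (\<integral>\<^sup>+ z. h (f z) \<partial>Q)"
    and I: "finite I" and Bs: "countable Bs" "Bs \<subseteq> sets N"
    and s: "\<And>x. card (trace_of I x ` Bs) \<le> s"
    and v: "0 < v" and \<delta>: "0 < \<delta>" "\<delta> < 1" and k: "0 < k" and s1: "1 \<le> s"
  shows "measure (PiM I (\<lambda>_. Q)) {z \<in> space (PiM I (\<lambda>_. Q)). \<exists>B\<in>Bs.
      k \<le> card (trace_of I (\<lambda>i. f (z i)) B) \<and>
      real (card (trace_of I (\<lambda>i. f (z i)) B)) * sqrt (2 * v * ln (s / \<delta>) / k)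
        < (\<Sum>i\<in>trace_of I (\<lambda>i. f (z i)) B. e (z i))} \<le> \<delta>"
proof -
  interpret PI: prob_space "PiM I (\<lambda>_. Q)" by (rule prob_space_PiM) (rule Q)
  define c where "c = sqrt (2 * v * ln (s / \<delta>) / k)"
  \<comment> \<open>This choice maximises \<open>t * c - t\<^sup>2 * v / 2\<close>, with value
    \<open>c\<^sup>2 / (2 * v) = ln (s / \<delta>) / k\<close>.\<close>
  define t where "t = c / v"
  define w where "w z = ennreal (exp (t * e z - t\<^sup>2 * v / 2))" for z
  define F where "F z = (SUP B\<in>Bs. \<Prod>i\<in>trace_of I (\<lambda>i. f (z i)) B. w (z i))" for z
  define E where "E = {z \<in> space (PiM I (\<lambda>_. Q)). \<exists>B\<in>Bs.
      k \<le> card (trace_of I (\<lambda>i. f (z i)) B) \<and>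
      real (card (trace_of I (\<lambda>i. f (z i)) B)) * c < (\<Sum>i\<in>trace_of I (\<lambda>i. f (z i)) B. e (z i))}"
  have w: "w \<in> borel_measurable Q" unfolding w_def using e by measurable
  have contr: "(\<integral>\<^sup>+ z. h (f z) * w z \<partial>Q) \<le> (\<integral>\<^sup>+ z. h (f z) \<partial>Q)" if h: "h \<in> borel_measurable N" for h
  proof -
    let ?d = "ennreal (exp (- (t\<^sup>2 * v / 2)))"
    have "exp (t * e z - t\<^sup>2 * v / 2) = exp (- (t\<^sup>2 * v / 2)) * exp (t * e z)" for z
      by (simp flip: exp_add)
    then have "h (f z) * w z = ?d * (h (f z) * ennreal (exp (t * e z)))" for z
      by (simp add: w_def ennreal_mult mult_ac)
    then have "(\<integral>\<^sup>+ z. h (f z) * w z \<partial>Q) = ?d * (\<integral>\<^sup>+ z. h (f z) * ennreal (exp (t * e z)) \<partial>Q)"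
      using e measurable_compose[OF f h] by (simp add: nn_integral_cmult)
    also have "\<dots> \<le> ?d * (ennreal (exp (t\<^sup>2 * v / 2)) * (\<integral>\<^sup>+ z. h (f z) \<partial>Q))"
      by (intro mult_left_mono sub_gaussian h) auto
    also have "\<dots> = (\<integral>\<^sup>+ z. h (f z) \<partial>Q)"
      by (simp add: mult.assoc[symmetric] exp_minus flip: ennreal_mult)
    finally show ?thesis .
  qed
  have F_int: "(\<integral>\<^sup>+ z. F z \<partial>PiM I (\<lambda>_. Q)) \<le> of_nat s"
    unfolding F_def by (rule nn_integral_SUP_prod_trace_le[OF Q f w contr I Bs s])
  have large: "ennreal (s / \<delta>) \<le> F z" if "z \<in> E" for z
  proof -
    obtain B where B: "B \<in> Bs" and kB: "k \<le> card (trace_of I (\<lambda>i. f (z i)) B)"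
      and sum: "real (card (trace_of I (\<lambda>i. f (z i)) B)) * c < (\<Sum>i\<in>trace_of I (\<lambda>i. f (z i)) B. e (z i))"
      using \<open>z \<in> E\<close> unfolding E_def by blast
    define A where "A = trace_of I (\<lambda>i. f (z i)) B"
    have lnpos: "ln (s / \<delta>) \<ge> 0" using s1 \<delta> by (simp add: field_simps)
    have c2: "c\<^sup>2 = 2 * v * ln (s / \<delta>) / k" unfolding c_def using lnpos v by simp
    have "c \<ge> 0" unfolding c_def using lnpos v by simp
    \<comment> \<open>Each point of the trace contributes \<open>ln (s / \<delta>) / k\<close> to
      the exponent, so traces with more than \<open>k\<close> points only help and one
      \<open>t\<close> suffices for all sizes.\<close>
    have "ln (s / \<delta>) = real k * (ln (s / \<delta>) / k)" using k by simp
    also have "\<dots> \<le> real (card A) * (ln (s / \<delta>) / k)"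
      using kB lnpos unfolding A_def by (intro mult_right_mono) auto
    also have "\<dots> = t * (real (card A) * c) - real (card A) * (t\<^sup>2 * v / 2)"
      using v k c2 by (simp add: t_def field_simps power2_eq_square)
    also have "\<dots> \<le> t * (\<Sum>i\<in>A. e (z i)) - real (card A) * (t\<^sup>2 * v / 2)"
      using sum \<open>c \<ge> 0\<close> v unfolding A_def t_def by (intro diff_right_mono mult_left_mono) auto
    also have "\<dots> = (\<Sum>i\<in>A. t * e (z i) - t\<^sup>2 * v / 2)"
      by (simp add: sum_subtractf sum_distrib_left)
    finally have "exp (ln (s / \<delta>)) \<le> exp (\<Sum>i\<in>A. t * e (z i) - t\<^sup>2 * v / 2)" by simp
    then have "s / \<delta> \<le> exp (\<Sum>i\<in>A. t * e (z i) - t\<^sup>2 * v / 2)"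
      using s1 \<delta> by simp
    then have "ennreal (s / \<delta>) \<le> ennreal (exp (\<Sum>i\<in>A. t * e (z i) - t\<^sup>2 * v / 2))"
      by (rule ennreal_leI)
    also have "\<dots> = (\<Prod>i\<in>A. w (z i))"
      using I by (simp add: w_def exp_sum prod_ennreal A_def trace_of_def)
    also have "\<dots> \<le> F z" unfolding F_def A_def by (intro SUP_upper B)
    finally show ?thesis .
  qed
  have "E \<in> sets (PiM I (\<lambda>_. Q))"
    unfolding E_def by (rule sets_trace_sum_large[OF f e I Bs])
  then have "ennreal (s / \<delta>) * emeasure (PiM I (\<lambda>_. Q)) E
      = (\<integral>\<^sup>+ z. ennreal (s / \<delta>) * indicator E z \<partial>PiM I (\<lambda>_. Q))"
    by (simp add: nn_integral_cmult_indicator)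
  also have "\<dots> \<le> (\<integral>\<^sup>+ z. F z \<partial>PiM I (\<lambda>_. Q))"
    using large by (intro nn_integral_mono) (auto simp: indicator_def)
  also have "\<dots> \<le> ennreal (real s)"
    using F_int by (simp add: ennreal_of_nat_eq_real_of_nat)
  finally have "s / \<delta> * measure (PiM I (\<lambda>_. Q)) E \<le> s"
    using \<delta> by (simp add: PI.emeasure_eq_measure flip: ennreal_mult)
  then show ?thesis
    unfolding E_def[symmetric] c_def[symmetric] using s1 \<delta> by (simp add: field_simps)
qed

text \<open>For \<open>v = 0\<close> the Chernoff parameter of the positive case is undefined; the claim follows
  by letting \<open>v\<close> decrease to \<open>0\<close>.\<close>

lemma prob_trace_sum_large_le:
  fixes Q :: "'z measure" and N :: "'a measure" and e :: "'z \<Rightarrow> real" and I :: "'i set"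
    and v \<delta> :: real and k s :: nat
  assumes Q: "prob_space Q" and f: "f \<in> Q \<rightarrow>\<^sub>M N" and e: "e \<in> borel_measurable Q"
    and sub_gaussian: "\<And>t h. h \<in> borel_measurable N \<Longrightarrow>
      (\<integral>\<^sup>+ z. h (f z) * ennreal (exp (t * e z)) \<partial>Q) \<le> ennreal (exp (t\<^sup>2 * v / 2)) * (\<integral>\<^sup>+ z. h (f z) \<partial>Q)"
    and I: "finite I" and Bs: "countable Bs" "Bs \<subseteq> sets N"
    and s: "\<And>x. card (trace_of I x ` Bs) \<le> s"
    and v: "0 \<le> v" and \<delta>: "0 < \<delta>" "\<delta> < 1" and k: "0 < k" and s1: "1 \<le> s"
  shows "measure (PiM I (\<lambda>_. Q)) {z \<in> space (PiM I (\<lambda>_. Q)). \<exists>B\<in>Bs.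
      k \<le> card (trace_of I (\<lambda>i. f (z i)) B) \<and>
      real (card (trace_of I (\<lambda>i. f (z i)) B)) * sqrt (2 * v * ln (s / \<delta>) / k)
        < (\<Sum>i\<in>trace_of I (\<lambda>i. f (z i)) B. e (z i))} \<le> \<delta>"
proof -
  interpret PI: prob_space "PiM I (\<lambda>_. Q)" by (rule prob_space_PiM) (rule Q)
  let ?N = "\<lambda>z B. card (trace_of I (\<lambda>i. f (z i)) B)"
  let ?S = "\<lambda>z B. \<Sum>i\<in>trace_of I (\<lambda>i. f (z i)) B. e (z i)"
  define c where "c u = sqrt (2 * u * ln (s / \<delta>) / k)" for u
  define u where "u m = v + 1 / Suc m" for m :: nat
  define E where "E a = {z \<in> space (PiM I (\<lambda>_. Q)). \<exists>B\<in>Bs. k \<le> ?N z B \<and> real (?N z B) * a < ?S z B}" for a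
  have E: "E a \<in> sets (PiM I (\<lambda>_. Q))" for a
    unfolding E_def by (rule sets_trace_sum_large[OF f e I Bs])
  have lnpos: "ln (s / \<delta>) \<ge> 0" using s1 \<delta> by (simp add: field_simps)
  have c_mono: "c a \<le> c b" if "a \<le> b" for a b
    unfolding c_def using that lnpos
    by (intro real_sqrt_le_mono divide_right_mono mult_right_mono) auto
  have Eu: "PI.prob (E (c (u m))) \<le> \<delta>" for m
  proof -
    have "u m > 0" using v by (simp add: u_def add_nonneg_pos)
    have *: "(\<integral>\<^sup>+ z. h (f z) * ennreal (exp (t * e z)) \<partial>Q) \<le> ennreal (exp (t\<^sup>2 * u m / 2)) * (\<integral>\<^sup>+ z. h (f z) \<partial>Q)"
      if "h \<in> borel_measurable N" for t h
      using sub_gaussian[OF that, of t]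
      by (rule order_trans) (auto simp: u_def intro!: mult_right_mono ennreal_leI mult_left_mono)
    show ?thesis
      unfolding E_def c_def
      by (rule prob_trace_sum_large_le_pos[OF Q f e * I Bs s \<open>u m > 0\<close> \<delta> k s1])
  qed
  \<comment> \<open>As \<open>u m\<close> decreases to \<open>v\<close> the thresholds decrease and
    the events grow, so continuity from below carries the bound to their union.\<close>
  have "incseq (\<lambda>m. E (c (u m)))"
  proof (rule incseq_SucI)
    fix m
    have "c (u (Suc m)) \<le> c (u m)"
      by (rule c_mono) (auto simp: u_def field_simps)
    then have "real (?N z B) * c (u (Suc m)) < ?S z B" if "real (?N z B) * c (u m) < ?S z B" for z B
      using that by (meson le_less_trans mult_left_mono of_nat_0_le_iff)
    then show "E (c (u m)) \<subseteq> E (c (u (Suc m)))" unfolding E_def by blast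
  qed
  then have "(\<lambda>m. PI.prob (E (c (u m)))) \<longlonglongrightarrow> PI.prob (\<Union>m. E (c (u m)))"
    using E by (intro PI.finite_Lim_measure_incseq) auto
  then have "PI.prob (\<Union>m. E (c (u m))) \<le> \<delta>"
    by (rule LIMSEQ_le_const2) (use Eu in auto)
  moreover have "E (c v) \<subseteq> (\<Union>m. E (c (u m)))"
  proof
    fix z assume "z \<in> E (c v)"
    then obtain B where z: "z \<in> space (PiM I (\<lambda>_. Q))" and B: "B \<in> Bs" "k \<le> ?N z B"
      and less: "real (?N z B) * c v < ?S z B"
      unfolding E_def by blast
    \<comment> \<open>The inequality at the limiting threshold is strict, so it already holds at
      \<open>c (u m)\<close> for large \<open>m\<close>; hence the limiting event lies in the
      union.\<close>
    have "(\<lambda>m. 1 / Suc m) \<longlonglongrightarrow> (0 :: real)"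
      using LIMSEQ_inverse_real_of_nat by (simp add: inverse_eq_divide)
    then have "(\<lambda>m. real (?N z B) * c (u m)) \<longlonglongrightarrow> real (?N z B) * sqrt (2 * (v + 0) * ln (s / \<delta>) / k)"
      unfolding c_def u_def using k by (intro tendsto_intros) auto
    then have "\<forall>\<^sub>F m in sequentially. real (?N z B) * c (u m) < ?S z B"
      using less by (intro order_tendstoD) (auto simp: c_def)
    then obtain m where "real (?N z B) * c (u m) < ?S z B"
      by (auto simp: eventually_sequentially)
    then show "z \<in> (\<Union>m. E (c (u m)))" using z B unfolding E_def by blast
  qed
  then have "PI.prob (E (c v)) \<le> PI.prob (\<Union>m. E (c (u m)))"
    using E by (intro PI.finite_measure_mono sets.countable_UN) auto
  ultimately show ?thesis unfolding E_def c_def by simp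
qed

section \<open>The nearest neighbour estimate\<close>

text \<open>Testing the conditional bound against nonnegative functions of \<open>X\<close> removes
  the conditional expectation: \<open>h (X \<omega>)\<close> is measurable for
  \<open>sigma_gen M X\<close>. The resulting form depends only on the joint law and thus transfers
  to the sample.\<close>

lemma cond_sub_gaussian_nn_integral_le:
  fixes X :: "'w \<Rightarrow> 'a::topological_space"
  assumes M: "prob_space M" and X: "X \<in> borel_measurable M" and e: "e \<in> borel_measurable M"
    and sg: "cond_sub_gaussian M X e v" and h: "h \<in> borel_measurable borel"
  shows "(\<integral>\<^sup>+ \<omega>. h (X \<omega>) * ennreal (exp (t * e \<omega>)) \<partial>M)
    \<le> ennreal (exp (t\<^sup>2 * v / 2)) * (\<integral>\<^sup>+ \<omega>. h (X \<omega>) \<partial>M)"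
proof -
  interpret prob_space M by fact
  let ?F = "sigma_gen M X"
  have sub: "subalgebra M ?F"
    unfolding subalgebra_def sigma_gen_def using sets_image_in_sets[OF refl X] by simp
  interpret finite_measure_subalgebra M ?F by standard (rule sub)
  have "X \<in> ?F \<rightarrow>\<^sub>M borel"
    unfolding sigma_gen_def by (rule measurable_vimage_algebra1) auto
  then have hX: "(\<lambda>\<omega>. h (X \<omega>)) \<in> borel_measurable ?F" by (rule measurable_compose[OF _ h])
  have ee: "(\<lambda>\<omega>. ennreal (exp (t * e \<omega>))) \<in> borel_measurable M" using e by measurable
  have "(\<integral>\<^sup>+ \<omega>. h (X \<omega>) * ennreal (exp (t * e \<omega>)) \<partial>M)
      = (\<integral>\<^sup>+ \<omega>. h (X \<omega>) * nn_cond_exp M ?F (\<lambda>\<omega>. ennreal (exp (t * e \<omega>))) \<omega> \<partial>M)"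
    by (rule nn_cond_exp_intg[OF hX ee, symmetric])
  also have "\<dots> \<le> (\<integral>\<^sup>+ \<omega>. h (X \<omega>) * ennreal (exp (t\<^sup>2 * v / 2)) \<partial>M)"
  proof (rule nn_integral_mono_AE)
    have "AE \<omega> in M. nn_cond_exp M ?F (\<lambda>\<omega>. ennreal (exp (t * e \<omega>))) \<omega> \<le> ennreal (exp (t\<^sup>2 * v / 2))"
      using sg unfolding cond_sub_gaussian_def by blast
    then show "AE \<omega> in M. h (X \<omega>) * nn_cond_exp M ?F (\<lambda>\<omega>. ennreal (exp (t * e \<omega>))) \<omega>
        \<le> h (X \<omega>) * ennreal (exp (t\<^sup>2 * v / 2))"
      by eventually_elim (rule mult_left_mono, auto)
  qed
  also have "\<dots> = ennreal (exp (t\<^sup>2 * v / 2)) * (\<integral>\<^sup>+ \<omega>. h (X \<omega>) \<partial>M)"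
    using measurable_compose[OF X h] by (simp add: nn_integral_multc mult.commute)
  finally show ?thesis .
qed

section \<open>Deterministic bounds: local Lipschitz constants, radius and bias\<close>

lemma lipschitz_const_nonneg:
  assumes "L-lipschitz_on S g"
  shows "0 \<le> lipschitz_const g S V"
proof -
  have "L-lipschitz_on (V \<inter> S) g" using assms by (rule lipschitz_on_subset) auto
  then show ?thesis
    unfolding lipschitz_const_def by (intro cInf_greatest) (auto intro: lipschitz_on_nonneg)
qed

text \<open>Every admissible constant dominates the difference quotient, hence so does their
  infimum. The global constant \<open>L\<close> ensures that the infimum is over a nonempty
  set.\<close>

lemma lipschitz_const_bound:
  assumes "L-lipschitz_on S g" and "y \<in> V \<inter> S" "z \<in> V \<inter> S"
  shows "\<bar>g y - g z\<bar> \<le> lipschitz_const g S V * dist y z"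
proof (cases "y = z")
  case False
  have "L-lipschitz_on (V \<inter> S) g" using assms(1) by (rule lipschitz_on_subset) auto
  moreover have "\<bar>g y - g z\<bar> / dist y z \<le> C" if "C-lipschitz_on (V \<inter> S) g" for C
    using lipschitz_onD[OF that assms(2,3)] False by (simp add: dist_real_def divide_le_eq)
  ultimately have "\<bar>g y - g z\<bar> / dist y z \<le> lipschitz_const g S V"
    unfolding lipschitz_const_def by (intro cInf_greatest) auto
  then show ?thesis using False by (simp add: divide_le_eq)
qed simp

lemma sum_indicator_eq_card_trace:
  "finite I \<Longrightarrow> (\<Sum>i\<in>I. indicator V (xs i) :: real) = card (trace_of I xs V)"
  by (simp add: trace_of_def indicator_def sum.If_cases Int_def)

text \<open>For closed balls the count is unchanged by a slight enlargement, so the ball whose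
  radius is the infimum holds \<open>k\<close> points as well, even if that radius is 0.\<close>

lemma knn_radius_bounds:
  fixes xs :: "nat \<Rightarrow> 'a::metric_space"
  assumes \<tau>: "0 < \<tau>" and k: "k \<le> card (trace_of {1..n} xs (cball x \<tau>))"
  shows "knn_radius n k xs x \<le> \<tau>" and "0 \<le> knn_radius n k xs x"
    and "k \<le> card (trace_of {1..n} xs (knn_map n k xs x))"
proof -
  define R where "R = {\<tau>. 0 < \<tau> \<and> k \<le> card (trace_of {1..n} xs (cball x \<tau>))}"
  define r where "r = knn_radius n k xs x"
  have r: "r = Inf R"
    by (simp add: r_def R_def knn_radius_def sum_indicator_eq_card_trace del: One_nat_def)
  have "\<tau> \<in> R" using assms by (simp add: R_def)
  have bdd: "bdd_below R" by (rule bdd_belowI[of _ 0]) (auto simp: R_def)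
  show "knn_radius n k xs x \<le> \<tau>"
    using cInf_lower[OF \<open>\<tau> \<in> R\<close> bdd] r r_def by simp
  show "0 \<le> knn_radius n k xs x"
    unfolding r_def[symmetric] r using \<open>\<tau> \<in> R\<close> by (intro cInf_greatest) (auto simp: R_def)
  obtain e where e: "e > 0" "trace_of {1..n} xs (cball x (r + e)) = trace_of {1..n} xs (cball x r)"
    using cball_enlarge_same_trace[of "{1..n}"] by blast
  obtain t where t: "t \<in> R" "t < r + e"
    using cInf_lessD[of R "r + e"] \<open>\<tau> \<in> R\<close> e r by auto
  have "k \<le> card (trace_of {1..n} xs (cball x t))" using t by (simp add: R_def)
  also have "\<dots> \<le> card (trace_of {1..n} xs (cball x (r + e)))"
    using t by (intro card_mono) (auto simp: trace_of_def)
  finally show "k \<le> card (trace_of {1..n} xs (knn_map n k xs x))"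
    using e by (simp add: knn_map_def r_def)
qed

text \<open>The error splits into the averages of the noise and of \<open>g (xs i) - g x\<close>
  over the neighbourhood. Its radius depends on the sample, so \<open>noise\<close> is required for
  every radius that captures \<open>k\<close> points.\<close>

lemma knn_estimate_error_le:
  fixes xs :: "nat \<Rightarrow> 'a::metric_space" and ys :: "nat \<Rightarrow> real" and c :: real
  assumes k: "0 < k" and \<tau>: "0 < \<tau>" "k \<le> card (trace_of {1..n} xs (cball x \<tau>))"
    and S: "x \<in> S" "\<And>i. i \<in> {1..n} \<Longrightarrow> xs i \<in> S" and g: "L-lipschitz_on S g"
    and noise: "\<And>r. k \<le> card (trace_of {1..n} xs (cball x r)) \<Longrightarrow>
      \<bar>\<Sum>i\<in>trace_of {1..n} xs (cball x r). ys i - g (xs i)\<bar> \<le> card (trace_of {1..n} xs (cball x r)) * c"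
  shows "\<bar>local_estimator n xs ys (knn_map n k xs) x - g x\<bar>
    \<le> c + \<tau> * lipschitz_const g S (knn_map n k xs x)"
proof -
  let ?V = "knn_map n k xs x"
  define T where "T = trace_of {1..n} xs ?V"
  define l where "l = lipschitz_const g S ?V"
  note r = knn_radius_bounds[OF \<tau>]
  have T: "0 < card T" using r(3) k by (simp add: T_def)
  have "(\<Sum>i=1..n. ys i * indicator ?V (xs i)) = (\<Sum>i\<in>T. ys i)"
    by (simp add: T_def trace_of_def indicator_def sum.If_cases Int_def if_distrib cong: if_cong)
  then have "local_estimator n xs ys (knn_map n k xs) x = (\<Sum>i\<in>T. ys i) / card T"
    unfolding local_estimator_def by (simp only: sum_indicator_eq_card_trace finite_atLeastAtMost T_def)
  then have "local_estimator n xs ys (knn_map n k xs) x - g x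
      = ((\<Sum>i\<in>T. ys i - g (xs i)) + (\<Sum>i\<in>T. g (xs i) - g x)) / card T"
    using T by (simp add: sum_subtractf field_simps)
  moreover have "\<bar>\<Sum>i\<in>T. ys i - g (xs i)\<bar> \<le> card T * c"
    using noise[of "knn_radius n k xs x"] r(3) by (simp add: T_def knn_map_def)
  moreover have "\<bar>\<Sum>i\<in>T. g (xs i) - g x\<bar> \<le> card T * (\<tau> * l)"
  proof -
    have "\<bar>g (xs i) - g x\<bar> \<le> \<tau> * l" if "i \<in> T" for i
    proof -
      have i: "i \<in> {1..n}" "xs i \<in> ?V" using that by (auto simp: T_def trace_of_def)
      have "x \<in> ?V" using r(2) by (simp add: knn_map_def)
      then have "\<bar>g (xs i) - g x\<bar> \<le> l * dist (xs i) x"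
        unfolding l_def using i S by (intro lipschitz_const_bound[OF g]) auto
      also have "\<dots> \<le> l * \<tau>"
        using i(2) r(1) lipschitz_const_nonneg[OF g]
        by (intro mult_left_mono) (auto simp: knn_map_def dist_commute l_def)
      finally show ?thesis by (simp add: mult.commute)
    qed
    then have "(\<Sum>i\<in>T. \<bar>g (xs i) - g x\<bar>) \<le> card T * (\<tau> * l)"
      by (rule sum_bounded_above)
    then show ?thesis using sum_abs[of "\<lambda>i. g (xs i) - g x" T] by linarith
  qed
  ultimately have "\<bar>local_estimator n xs ys (knn_map n k xs) x - g x\<bar>
      \<le> (card T * c + card T * (\<tau> * l)) / card T"
    by (auto simp: abs_divide intro!: divide_right_mono)
  also have "\<dots> = c + \<tau> * l" using T by (simp add: field_simps)
  finally show ?thesis unfolding l_def .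
qed

text \<open>The mass bound is assumed only below \<open>T0\<close>, while the radius used may equal
  \<open>T0\<close>. Monotonicity of the mass and a limit from the left close the gap.\<close>

lemma measure_cball_ge_at_endpoint:
  fixes P :: "'a::metric_space measure"
  assumes P: "finite_measure P" "sets P = sets borel" and "0 < \<tau>" "\<tau> \<le> T0"
    and lower: "\<And>t. 0 < t \<Longrightarrow> t < T0 \<Longrightarrow> l * t ^ d \<le> measure P (cball x t)"
  shows "l * \<tau> ^ d \<le> measure P (cball x \<tau>)"
proof (rule tendsto_upperbound)
  interpret finite_measure P by fact
  show "((\<lambda>t. l * t ^ d) \<longlongrightarrow> l * \<tau> ^ d) (at_left \<tau>)" by (intro tendsto_intros)
  have "l * t ^ d \<le> measure P (cball x \<tau>)" if "t \<in> {0<..<\<tau>}" for t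
  proof -
    have "l * t ^ d \<le> measure P (cball x t)" using that assms by (intro lower) auto
    also have "\<dots> \<le> measure P (cball x \<tau>)" using that P(2) by (intro finite_measure_mono) auto
    finally show ?thesis .
  qed
  then show "\<forall>\<^sub>F t in at_left \<tau>. l * t ^ d \<le> measure P (cball x \<tau>)"
    using \<open>0 < \<tau>\<close> by (rule eventually_at_leftI)
qed simp

theorem theorem13:
  fixes M :: "'w measure"
    and X :: "'w \<Rightarrow> real ^ 'd" and Y :: "'w \<Rightarrow> real"
    and Xs :: "nat \<Rightarrow> 'w \<Rightarrow> real ^ 'd" and Ys :: "nat \<Rightarrow> 'w \<Rightarrow> real"
    and S :: "(real ^ 'd) set" and g l :: "real ^ 'd \<Rightarrow> real"
    and n k :: nat and \<delta> \<sigma> L T0 :: real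
  assumes "prob_space M"
    and "0 < \<delta>" and "\<delta> < 1 / 3" and "n \<ge> 1"
    and "real k \<ge> 8 * ln (4 * (2 * real n + 1) ^ (CARD('d) + 1) / \<delta>)"
    and "iid M {0..n} (\<lambda>i \<omega>. if i = 0 then (X \<omega>, Y \<omega>) else (Xs i \<omega>, Ys i \<omega>))"
    and "AE \<omega> in M. X \<omega> \<in> S" and "\<forall>i\<in>{1..n}. AE \<omega> in M. Xs i \<omega> \<in> S"
    and "regression_fun M X Y g"
    and "cond_sub_gaussian M X (\<lambda>\<omega>. Y \<omega> - g (X \<omega>)) (\<sigma>\<^sup>2)"
    and "L-lipschitz_on S g"
    and "\<forall>x\<in>S. 0 < l x" and "0 < T0"
    and "\<forall>x\<in>S. \<forall>\<tau>\<in>{0<..<T0}. measure (distr M borel X) (cball x \<tau>) \<ge> l x * \<tau> ^ CARD('d)"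
  shows "\<exists>A\<in>sets M. measure M A \<ge> 1 - 3 * \<delta> \<and>
    (\<forall>\<omega>\<in>A. \<forall>x\<in>S. 2 * real k \<le> T0 ^ CARD('d) * real n * l x \<longrightarrow>
      (let V = knn_map n k (\<lambda>i. Xs i \<omega>) in
        \<bar>local_estimator n (\<lambda>i. Xs i \<omega>) (\<lambda>i. Ys i \<omega>) V x - g x\<bar>
          \<le> sqrt (2 * \<sigma>\<^sup>2 * ln ((real n + 1) ^ (CARD('d) + 1) / \<delta>) / real k)
            + 2 * (2 * real k / (real n * l x)) powr (1 / real CARD('d))
                * lipschitz_const g S (V x)))"
proof -
  interpret prob_space M by fact
  let ?I = "{1..n}" and ?d = "CARD('d)"
  define Z where "Z = (\<lambda>(i::nat) \<omega>. if i = 0 then (X \<omega>, Y \<omega>) else (Xs i \<omega>, Ys i \<omega>))"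
  define Q :: "((real ^ 'd) \<times> real) measure" where "Q = distr M borel (Z 0)"
  define P :: "(real ^ 'd) measure" where "P = distr M borel X"
  \<comment> \<open>\<open>s\<close> bounds the number of traces on the sample, \<open>s2\<close>
    that on the sample joined with its ghost.\<close>
  define s where "s = (n + 1) ^ (?d + 1)"
  define s2 where "s2 = (2 * n + 1) ^ (?d + 1)"
  define c where "c = sqrt (2 * \<sigma>\<^sup>2 * ln (s / \<delta>) / k)"
  let ?Bs = "rational_balls :: (real ^ 'd) set set"

  \<comment> \<open>Laws of the sample and of its design points\<close>
  note iid = assms(6)[folded Z_def, unfolded iid_def]
  have indep: "indep_vars (\<lambda>_. borel) Z {0..n}" using iid by blast
  have same: "distr M borel (Z i) = Q" if "i \<in> {0..n}" for i
    unfolding Q_def using iid that by (meson atLeastAtMost_iff le0)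
  have rv: "Z i \<in> borel_measurable M" if "i \<in> {0..n}" for i
    using indep that unfolding indep_vars_def by auto
  have fst_Z: "X = (\<lambda>\<omega>. fst (Z 0 \<omega>))" and snd_Z: "Y = (\<lambda>\<omega>. snd (Z 0 \<omega>))"
    by (auto simp: Z_def)
  have fst_borel[measurable]: "fst \<in> borel_measurable (borel :: ((real ^ 'd) \<times> real) measure)"
    by (intro borel_measurable_continuous_onI continuous_on_fst continuous_on_id)
  have snd_borel[measurable]: "snd \<in> borel_measurable (borel :: ((real ^ 'd) \<times> real) measure)"
    by (intro borel_measurable_continuous_onI continuous_on_snd continuous_on_id)
  have X[measurable]: "X \<in> borel_measurable M"
    unfolding fst_Z by (rule measurable_compose[OF rv fst_borel]) simp
  have Y[measurable]: "Y \<in> borel_measurable M"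
    unfolding snd_Z by (rule measurable_compose[OF rv snd_borel]) simp
  have g[measurable]: "g \<in> borel_measurable borel" using assms(9) by (simp add: regression_fun_def)
  have sets_Q[measurable_cong]: "sets Q = sets borel" by (simp add: Q_def)
  have sets_P[measurable_cong]: "sets P = sets borel" by (simp add: P_def)
  have Q: "prob_space Q" unfolding Q_def by (rule prob_space_distr) (simp add: rv)
  have P: "prob_space P" unfolding P_def by (rule prob_space_distr) simp
  have balls: "countable ?Bs" "?Bs \<subseteq> sets borel"
    using countable_rational_balls rational_balls_subset by auto
  have s1: "1 \<le> s" unfolding s_def by (rule one_le_power) simp
  have traces: "card (trace_of I x ` ?Bs) \<le> (card I + 1) ^ (?d + 1)" if "finite I" for I :: "nat set" and x
    using card_ball_traces_le[OF that rational_balls_subset, of x] by simp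

  have k: "0 < k" and s2_exp: "real s2 * exp (- real k / 8) \<le> \<delta> / 4"
  proof -
    have "1 \<le> s2" unfolding s2_def by (rule one_le_power) simp
    then have "1 \<le> real s2" by simp
    then have gt: "1 < 4 * real s2 / \<delta>" using assms(2,3) by (simp add: field_simps)
    have "real s2 = (2 * real n + 1) ^ (?d + 1)"
      unfolding s2_def by (simp only: of_nat_power of_nat_add of_nat_mult of_nat_numeral of_nat_1)
    with assms(5) have k8: "8 * ln (4 * real s2 / \<delta>) \<le> k" by (simp only:)
    moreover have "0 < ln (4 * real s2 / \<delta>)" using gt by simp
    ultimately show "0 < k" by linarith
    have "exp (- real k / 8) \<le> exp (- ln (4 * real s2 / \<delta>))" using k8 by simp
    also have "\<dots> = inverse (4 * real s2 / \<delta>)" using gt by (simp add: exp_minus)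
    finally show "real s2 * exp (- real k / 8) \<le> \<delta> / 4"
      using \<open>1 \<le> real s2\<close> assms(2) by (simp add: field_simps)
  qed

  \<comment> \<open>Restriction to \<open>?I\<close> places the samples in the product spaces;
    independence and equal laws then identify their distributions with powers of \<open>Q\<close>
    and \<open>P\<close>.\<close>
  define R where "R \<omega> = (\<lambda>i\<in>?I. Z i \<omega>)" for \<omega>
  define RX where "RX \<omega> = (\<lambda>i\<in>?I. Xs i \<omega>)" for \<omega>
  have I_ne: "?I \<noteq> {}" using assms(4) by simp
  have indep_I: "indep_vars (\<lambda>_. borel) Z ?I" by (rule indep_vars_subset[OF indep]) auto
  have "distr M (PiM ?I (\<lambda>_. borel)) R = PiM ?I (\<lambda>i. distr M borel (Z i))"
    unfolding R_def using indep_I rv by (subst indep_vars_iff_distr_eq_PiM'[OF I_ne, symmetric]) auto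
  also have "\<dots> = PiM ?I (\<lambda>_. Q)" by (intro PiM_cong) (auto simp: same)
  finally have law_R: "distr M (PiM ?I (\<lambda>_. borel)) R = PiM ?I (\<lambda>_. Q)" .
  have R_meas: "R \<in> M \<rightarrow>\<^sub>M PiM ?I (\<lambda>_. borel)"
    unfolding R_def by (intro measurable_restrict rv) auto
  have fst_Zi: "fst (Z i \<omega>) = Xs i \<omega>" and snd_Zi: "snd (Z i \<omega>) = Ys i \<omega>" if "i \<in> ?I" for i \<omega>
    using that by (auto simp: Z_def)
  have P_eq: "P = distr Q borel fst"
    unfolding P_def Q_def fst_Z using rv by (subst distr_distr) (auto simp: comp_def)
  have indep_X: "indep_vars (\<lambda>_. borel) (\<lambda>i \<omega>. fst (Z i \<omega>)) ?I"
    using indep_vars_compose2[OF indep_I, of "\<lambda>_. fst" "\<lambda>_. borel"] by simp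
  have rvX: "(\<lambda>\<omega>. fst (Z i \<omega>)) \<in> borel_measurable M" if "i \<in> ?I" for i
    using that rv by (intro measurable_compose[OF rv]) auto
  have RX_eq: "RX \<omega> = (\<lambda>i\<in>?I. fst (Z i \<omega>))" for \<omega>
    unfolding RX_def by (intro restrict_ext) (simp add: fst_Zi)
  have "distr M (PiM ?I (\<lambda>_. borel)) RX = PiM ?I (\<lambda>i. distr M borel (\<lambda>\<omega>. fst (Z i \<omega>)))"
    unfolding RX_eq using indep_X rvX by (subst indep_vars_iff_distr_eq_PiM'[OF I_ne, symmetric]) auto
  also have "\<dots> = PiM ?I (\<lambda>_. P)"
  proof (intro PiM_cong refl)
    fix i assume i: "i \<in> ?I"
    have "distr M borel (\<lambda>\<omega>. fst (Z i \<omega>)) = distr (distr M borel (Z i)) borel fst"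
      using rv i by (subst distr_distr) (auto simp: comp_def)
    then show "distr M borel (\<lambda>\<omega>. fst (Z i \<omega>)) = P" using same i P_eq by simp
  qed
  finally have law_RX: "distr M (PiM ?I (\<lambda>_. borel)) RX = PiM ?I (\<lambda>_. P)" .
  have RX_meas: "RX \<in> M \<rightarrow>\<^sub>M PiM ?I (\<lambda>_. borel)"
    unfolding RX_eq by (intro measurable_restrict rvX)

  define noise where "noise z = snd z - g (fst z)" for z :: "(real ^ 'd) \<times> real"
  have noise[measurable]: "noise \<in> borel_measurable Q" unfolding noise_def by measurable
  have fst_Q: "fst \<in> Q \<rightarrow>\<^sub>M (borel :: (real ^ 'd) measure)" by measurable
  have sub_gaussian: "(\<integral>\<^sup>+ z. h (fst z) * ennreal (exp (t * noise z)) \<partial>Q)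
      \<le> ennreal (exp (t\<^sup>2 * \<sigma>\<^sup>2 / 2)) * (\<integral>\<^sup>+ z. h (fst z) \<partial>Q)"
    if [measurable]: "h \<in> borel_measurable borel" for t h
  proof -
    have "(\<integral>\<^sup>+ z. h (fst z) * ennreal (exp (t * noise z)) \<partial>Q)
        = (\<integral>\<^sup>+ \<omega>. h (X \<omega>) * ennreal (exp (t * (Y \<omega> - g (X \<omega>)))) \<partial>M)"
      unfolding Q_def noise_def using rv[of 0] by (subst nn_integral_distr) (auto simp: Z_def)
    moreover have "(\<integral>\<^sup>+ z. h (fst z) \<partial>Q) = (\<integral>\<^sup>+ \<omega>. h (X \<omega>) \<partial>M)"
      unfolding Q_def using rv[of 0] by (subst nn_integral_distr) (auto simp: Z_def)
    ultimately show ?thesis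
      using cond_sub_gaussian_nn_integral_le[OF assms(1) X _ assms(10) that, of t] by simp
  qed

  \<comment> \<open>The exceptional events and their probabilities\<close>
  define large where "large e = {z \<in> space (PiM ?I (\<lambda>_. Q)). \<exists>B\<in>?Bs.
      k \<le> card (trace_of ?I (\<lambda>i. fst (z i)) B) \<and>
      real (card (trace_of ?I (\<lambda>i. fst (z i)) B)) * c < (\<Sum>i\<in>trace_of ?I (\<lambda>i. fst (z i)) B. e (z i))}"
    for e :: "(real ^ 'd) \<times> real \<Rightarrow> real"
  have large_sets: "large e \<in> sets (PiM ?I (\<lambda>_. Q))" if "e \<in> borel_measurable Q" for e
    unfolding large_def by (rule sets_trace_sum_large[OF fst_Q that _ balls]) simp
  have large_prob: "measure (PiM ?I (\<lambda>_. Q)) (large e) \<le> \<delta>"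
    if e: "e \<in> borel_measurable Q" and sg: "\<And>t h. h \<in> borel_measurable (borel :: (real ^ 'd) measure) \<Longrightarrow>
      (\<integral>\<^sup>+ z. h (fst z) * ennreal (exp (t * e z)) \<partial>Q)
        \<le> ennreal (exp (t\<^sup>2 * \<sigma>\<^sup>2 / 2)) * (\<integral>\<^sup>+ z. h (fst z) \<partial>Q)" for e
    unfolding large_def c_def
    using assms(2,3) k s1 traces[of ?I]
    by (intro prob_trace_sum_large_le[OF Q fst_Q e sg _ balls]) (auto simp: s_def simp del: power_Suc power_add)
  define E1 where "E1 = {x \<in> space (PiM ?I (\<lambda>_. P)).
      \<exists>B\<in>?Bs. 2 * real k \<le> real n * measure P B \<and> card (trace_of ?I x B) < k}"
  have E1_sets: "E1 \<in> sets (PiM ?I (\<lambda>_. P))"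
    unfolding E1_def using balls by (intro sets_sparse_heavy_set) (auto simp: sets_P)
  have "measure (PiM ?I (\<lambda>_. P)) E1 \<le> real s2 * exp (- real k / 8)"
    unfolding E1_def using traces[of "{1..2*n}"] balls
    by (intro prob_sparse_heavy_set_le[OF P]) (auto simp: sets_P s2_def)
  with s2_exp have E1_prob: "measure (PiM ?I (\<lambda>_. P)) E1 \<le> \<delta> / 4" by simp

  have "AE \<omega> in M. \<forall>i\<in>?I. Xs i \<omega> \<in> S"
    by (rule AE_finite_allI) (use assms(8) in auto)
  \<comment> \<open>\<open>N\<close> is a measurable null set enclosing the outcomes in which some
    sample point leaves \<open>S\<close>, a set not assumed measurable.\<close>
  then obtain N where N: "{\<omega> \<in> space M. \<not> (\<forall>i\<in>?I. Xs i \<omega> \<in> S)} \<subseteq> N" "emeasure M N = 0" "N \<in> sets M"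
    by (rule AE_E)
  let ?pull = "\<lambda>R E. R -` E \<inter> space M"
  define bad1 where "bad1 = ?pull RX E1"
  define bad2 where "bad2 = ?pull R (large noise)"
  define bad3 where "bad3 = ?pull R (large (\<lambda>z. - noise z))"
  have pull: "?pull R E \<in> events" "prob (?pull R E) = measure (PiM ?I (\<lambda>_. Q')) E"
    if "R \<in> M \<rightarrow>\<^sub>M PiM ?I (\<lambda>_. borel)" "distr M (PiM ?I (\<lambda>_. borel)) R = PiM ?I (\<lambda>_. Q')"
      "E \<in> sets (PiM ?I (\<lambda>_. Q'))" for R E and Q' :: "'b::topological_space measure"
  proof -
    have "E \<in> sets (PiM ?I (\<lambda>_. borel))" using that(2,3) by (metis sets_distr)
    then show "?pull R E \<in> events" "prob (?pull R E) = measure (PiM ?I (\<lambda>_. Q')) E"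
      using measurable_sets[OF that(1)] measure_distr[OF that(1)] that(2) by metis+
  qed
  have bad1: "bad1 \<in> events" "prob bad1 \<le> \<delta> / 4"
    using pull[OF RX_meas law_RX E1_sets] E1_prob unfolding bad1_def by simp_all
  have bad2: "bad2 \<in> events" "prob bad2 \<le> \<delta>"
    using pull[OF R_meas law_R large_sets[OF noise]] large_prob[OF noise sub_gaussian]
    unfolding bad2_def by simp_all
  have neg_noise: "(\<lambda>z. - noise z) \<in> borel_measurable Q" by measurable
  have sub_gaussian_neg: "(\<integral>\<^sup>+ z. h (fst z) * ennreal (exp (t * - noise z)) \<partial>Q)
      \<le> ennreal (exp (t\<^sup>2 * \<sigma>\<^sup>2 / 2)) * (\<integral>\<^sup>+ z. h (fst z) \<partial>Q)"
    if "h \<in> borel_measurable borel" for t h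
    using sub_gaussian[OF that, of "- t"] by simp
  have bad3: "bad3 \<in> events" "prob bad3 \<le> \<delta>"
    using pull[OF R_meas law_R large_sets[OF neg_noise]] large_prob[OF neg_noise sub_gaussian_neg]
    unfolding bad3_def by simp_all
  \<comment> \<open>The failure budget is \<open>\<delta> / 4\<close> for sparse heavy balls,
    \<open>\<delta>\<close> for each sign of the noise, and zero for \<open>N\<close>.\<close>
  define A where "A = space M - (bad1 \<union> bad2 \<union> bad3 \<union> N)"
  have A_sets: "A \<in> events" unfolding A_def using bad1 bad2 bad3 N by auto
  have "prob (bad1 \<union> bad2 \<union> bad3 \<union> N) \<le> prob bad1 + prob bad2 + prob bad3 + prob N"
    using bad1(1) bad2(1) bad3(1) N(3)
    by (intro order_trans[OF measure_Un_le] add_right_mono) auto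
  also have "\<dots> \<le> 3 * \<delta>"
    using bad1 bad2 bad3 N(2) assms(2) by (simp add: measure_def)
  finally have A_prob: "1 - 3 * \<delta> \<le> prob A"
    unfolding A_def using bad1 bad2 bad3 N by (subst prob_compl) auto

  have trace_RX: "trace_of ?I (RX \<omega>) B = trace_of ?I (\<lambda>i. Xs i \<omega>) B" for \<omega> B
    by (auto simp: trace_of_def RX_def)
  have trace_R: "trace_of ?I (\<lambda>i. fst (R \<omega> i)) B = trace_of ?I (\<lambda>i. Xs i \<omega>) B" for \<omega> B
    by (auto simp: trace_of_def R_def Z_def)
  have sum_R: "(\<Sum>i\<in>trace_of ?I (\<lambda>i. Xs i \<omega>) B. noise (R \<omega> i))
      = (\<Sum>i\<in>trace_of ?I (\<lambda>i. Xs i \<omega>) B. Ys i \<omega> - g (Xs i \<omega>))" for \<omega> B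
    by (intro sum.cong) (auto simp: trace_of_def R_def Z_def noise_def)
  have R_space: "R \<omega> \<in> space (PiM ?I (\<lambda>_. Q))" and RX_space: "RX \<omega> \<in> space (PiM ?I (\<lambda>_. P))" for \<omega>
    using sets_eq_imp_space_eq[OF sets_Q] sets_eq_imp_space_eq[OF sets_P]
    by (auto simp: space_PiM R_def RX_def)

  \<comment> \<open>The error bound on the good event, for all query points at once\<close>
  have "\<bar>local_estimator n (\<lambda>i. Xs i \<omega>) (\<lambda>i. Ys i \<omega>) (knn_map n k (\<lambda>i. Xs i \<omega>)) x - g x\<bar>
      \<le> c + 2 * (2 * real k / (real n * l x)) powr (1 / real ?d)
          * lipschitz_const g S (knn_map n k (\<lambda>i. Xs i \<omega>) x)"
    if \<omega>: "\<omega> \<in> A" and x: "x \<in> S" and cond: "2 * real k \<le> T0 ^ ?d * real n * l x" for \<omega> x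
  proof -
    let ?xs = "\<lambda>i. Xs i \<omega>" and ?l = "lipschitz_const g S (knn_map n k (\<lambda>i. Xs i \<omega>) x)"
    define \<tau> where "\<tau> = (2 * real k / (real n * l x)) powr (1 / real ?d)"
    have lx: "0 < l x" and n: "0 < n" using assms(4,12) x by auto
    have pos: "0 < 2 * real k / (real n * l x)" using lx n k by simp
    then have \<tau>: "0 < \<tau>" using lx n k by (simp add: \<tau>_def)
    have \<tau>_pow: "\<tau> ^ ?d = 2 * real k / (real n * l x)"
    proof -
      have "\<tau> ^ ?d = \<tau> powr real ?d" using \<tau> by (simp add: powr_realpow)
      also have "\<dots> = (2 * real k / (real n * l x)) powr 1" unfolding \<tau>_def powr_powr by simp
      also have "\<dots> = 2 * real k / (real n * l x)" using pos by (intro powr_one) simp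
      finally show ?thesis .
    qed
    \<comment> \<open>\<open>\<tau>\<close> solves \<open>l x * \<tau> ^ d = 2 * k / n\<close>, so
      its ball has the mass that forces \<open>k\<close> points. The condition on \<open>x\<close>
      says exactly that \<open>\<tau>\<close> does not exceed \<open>T0\<close>.\<close>
    have "\<tau> ^ ?d \<le> T0 ^ ?d" unfolding \<tau>_pow using cond lx n by (simp add: field_simps)
    then have "\<tau> \<le> T0" using assms(13) \<tau> by (simp add: power_mono_iff)
    then have "l x * \<tau> ^ ?d \<le> measure P (cball x \<tau>)"
      using assms(14) x \<tau> prob_space.finite_measure[OF P] sets_P
      by (intro measure_cball_ge_at_endpoint[of P \<tau> T0]) (auto simp: P_def)
    then have mass: "2 * real k \<le> real n * measure P (cball x \<tau>)"
      unfolding \<tau>_pow using lx n by (simp add: field_simps)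
    have many: "k \<le> card (trace_of ?I ?xs (cball x \<tau>))"
    proof -
      \<comment> \<open>Passing to a member of the countable family can only increase the mass and
        leaves the sample count unchanged.\<close>
      obtain B where B: "B \<in> ?Bs" "cball x \<tau> \<subseteq> B" "trace_of ?I ?xs B = trace_of ?I ?xs (cball x \<tau>)"
        using rational_ball_superset_same_trace[of ?I x \<tau> ?xs] by auto
      have "measure P (cball x \<tau>) \<le> measure P B"
        using B balls sets_P by (intro finite_measure.finite_measure_mono prob_space.finite_measure[OF P]) auto
      then have "2 * real k \<le> real n * measure P B" using mass n by (smt (verit) mult_left_mono of_nat_0_le_iff)
      moreover have "RX \<omega> \<notin> E1" using \<omega> by (auto simp: A_def bad1_def)
      ultimately have "\<not> card (trace_of ?I (RX \<omega>) B) < k"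
        using B(1) RX_space[of \<omega>] unfolding E1_def by blast
      then show ?thesis unfolding trace_RX B(3) by (simp only: not_less)
    qed
    have "\<bar>local_estimator n ?xs (\<lambda>i. Ys i \<omega>) (knn_map n k ?xs) x - g x\<bar> \<le> c + \<tau> * ?l"
    proof (rule knn_estimate_error_le[OF k \<tau> many x _ assms(11)])
      fix i assume "i \<in> ?I"
      moreover have "\<omega> \<in> space M" "\<omega> \<notin> N" using \<omega> by (auto simp: A_def)
      ultimately show "Xs i \<omega> \<in> S" using N(1) by blast
    next
      fix r assume r: "k \<le> card (trace_of ?I ?xs (cball x r))"
      obtain B where B: "B \<in> ?Bs" "trace_of ?I ?xs B = trace_of ?I ?xs (cball x r)"
        using rational_ball_superset_same_trace[of ?I x r ?xs] by auto
      let ?T = "trace_of ?I ?xs (cball x r)"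
      let ?S = "\<Sum>i\<in>?T. Ys i \<omega> - g (Xs i \<omega>)"
      have not_large: "\<not> real (card ?T) * c < (\<Sum>i\<in>?T. e (R \<omega> i))" if "R \<omega> \<notin> large e" for e
        using that B r R_space[of \<omega>] unfolding large_def mem_Collect_eq trace_R by metis
      have "R \<omega> \<notin> large noise" "R \<omega> \<notin> large (\<lambda>z. - noise z)"
        using \<omega> by (auto simp: A_def bad2_def bad3_def)
      from this[THEN not_large] have "\<not> real (card ?T) * c < ?S" "\<not> real (card ?T) * c < - ?S"
        unfolding sum_negf sum_R by this+
      then show "\<bar>?S\<bar> \<le> card ?T * c" by linarith
    qed
    \<comment> \<open>Both \<open>\<tau>\<close> and the Lipschitz constant are nonnegative, so the
      bias term may be doubled to reach the stated form.\<close>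
    also have "\<dots> \<le> c + 2 * \<tau> * ?l"
      using \<tau> lipschitz_const_nonneg[OF assms(11)] by simp
    finally show ?thesis unfolding \<tau>_def .
  qed
  moreover have "c = sqrt (2 * \<sigma>\<^sup>2 * ln ((real n + 1) ^ (?d + 1) / \<delta>) / real k)"
    unfolding c_def s_def by (simp only: of_nat_power of_nat_add of_nat_1)
  ultimately show ?thesis
    using A_sets A_prob unfolding Let_def by blast
qed

end
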